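(* Let $L=\mathbb{F}_{2^n}$ with $n$ a positive integer, let $k$ be a positive integer, and let $f(x)=x^{2^{2k}-2^k+1}+h(x)\in L[x]$, where $d=\deg(h)\equiv 5\pmod 8$. If $d<2^{2k}-3\cdot 2^k-1$ and the polynomials $\phi_{2^{2k}-2^k+1}$ and $\phi_d$ are relatively prime, then the polynomial $$\phi(x,y,z)=\frac{f(x)+f(y)+f(z)+f(x+y+z)}{(x+y)(x+z)(y+z)}$$ is absolutely irreducible.
   Context: For an integer $j\ge 3$, over a field of characteristic 2, put $$\phi_j(x,y,z)=\frac{x^j+y^j+z^j+(x+y+z)^j}{(x+y)(x+z)(y+z)},$$ which is a polynomial with coefficients in $\mathbb{F}_2$; likewise $\phi(x,y,z)$ is a polynomial in $L[x,y,z]$. A polynomial over $L$ is absolutely irreducible if it is irreducible over the algebraic closure $\overline{\mathbb{F}}_2$. Two polynomials are relatively prime if they have no non-constant common factor. *)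

theory Defs
  imports
    "HOL-Computational_Algebra.Computational_Algebra"
    "HOL-Algebra.Algebraic_Closure_Type"
    "HOL-Number_Theory.Cong"
    "HOL-Library.Cardinality"
begin

(* K[x,y,z] is modelled as the iterated polynomial ring K[x][y][z]:
   the innermost variable is x, the outermost one is z. *)
type_synonym 'a poly3 = "'a poly poly poly"

definition const3 :: "'a::comm_ring_1 \<Rightarrow> 'a poly3" where
  "const3 c = [:[:[:c:]:]:]"

definition X3 :: "'a::comm_ring_1 poly3" where
  "X3 = [:[:[:0, 1:]:]:]"

definition Y3 :: "'a::comm_ring_1 poly3" where
  "Y3 = [:[:0, 1:]:]"

definition Z3 :: "'a::comm_ring_1 poly3" where
  "Z3 = [:0, 1:]"

definition subst3 :: "'a::comm_ring_1 poly \<Rightarrow> 'a poly3 \<Rightarrow> 'a poly3" where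
  "subst3 f p = poly (map_poly const3 f) p"

definition phi_denom :: "'a::comm_ring_1 poly3" where
  "phi_denom = (X3 + Y3) * (X3 + Z3) * (Y3 + Z3)"

(* In the next two definitions the division is exact when K has characteristic 2;
   see phi_pow_exact and phi_poly_exact. In other characteristics the values carry
   no meaning. *)
definition phi_pow :: "nat \<Rightarrow> 'a::field poly3" where
  "phi_pow j = (X3 ^ j + Y3 ^ j + Z3 ^ j + (X3 + Y3 + Z3) ^ j) div phi_denom"

definition phi_poly :: "'a::field poly \<Rightarrow> 'a poly3" where
  "phi_poly f =
     (subst3 f X3 + subst3 f Y3 + subst3 f Z3 + subst3 f (X3 + Y3 + Z3)) div phi_denom"

definition absolutely_irreducible :: "'a::field poly3 \<Rightarrow> bool" where
  "absolutely_irreducible p \<longleftrightarrow>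
     irreducible (map_poly (map_poly (map_poly to_ac)) p :: 'a alg_closure poly3)"

lemma phi_denom_neq_0: "(phi_denom :: 'a::field poly3) \<noteq> 0"
  by (auto simp: phi_denom_def X3_def Y3_def Z3_def)

lemma power_sum_rec:
  fixes x y z t :: "'a::comm_ring_1"
  assumes t: "t = x + y + z" and two: "(2::'a) = 0"
  shows "x ^ (j + 4) + y ^ (j + 4) + z ^ (j + 4) + t ^ (j + 4) =
    (x*y + x*z + x*t + y*z + y*t + z*t) * (x ^ (j + 2) + y ^ (j + 2) + z ^ (j + 2) + t ^ (j + 2))
    + (x*y*z + x*y*t + x*z*t + y*z*t) * (x ^ (j + 1) + y ^ (j + 1) + z ^ (j + 1) + t ^ (j + 1))
    + x*y*z*t * (x ^ j + y ^ j + z ^ j + t ^ j)"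
proof -
  define e2 where "e2 = x*y + x*z + x*t + y*z + y*t + z*t"
  define e3 where "e3 = x*y*z + x*y*t + x*z*t + y*z*t"
  define e4 where "e4 = x*y*z*t"
  have root: "r ^ (j + 4) = e2 * r ^ (j + 2) + e3 * r ^ (j + 1) + e4 * r ^ j"
    if "r = x \<or> r = y \<or> r = z \<or> r = t" for r
  proof -
    have "(r - x) * (r - y) * (r - z) * (r - t) = 0"
      using that by auto
    moreover have "r ^ 4 = e2 * r ^ 2 + e3 * r + e4 + (r - x) * (r - y) * (r - z) * (r - t)
        + 2 * (t * r ^ 3 - e2 * r ^ 2 - e4)"
      unfolding e2_def e3_def e4_def t
      by (simp add: algebra_simps power2_eq_square power3_eq_cube power4_eq_xxxx)
    ultimately have "r ^ 4 = e2 * r ^ 2 + e3 * r + e4"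
      using two by simp
    hence "r ^ j * r ^ 4 = r ^ j * (e2 * r ^ 2 + e3 * r + e4)"
      by simp
    thus ?thesis
      by (simp add: power_add power2_eq_square algebra_simps)
  qed
  show ?thesis
    unfolding e2_def [symmetric] e3_def [symmetric] e4_def [symmetric]
    by (simp only: root [of x] root [of y] root [of z] root [of t] refl disj_absorb
        simp_thms) (simp add: algebra_simps)
qed

lemma denom_dvd_power_sum:
  fixes x y z :: "'a::comm_ring_1"
  assumes two: "(2::'a) = 0"
  shows "(x + y) * (x + z) * (y + z) dvd x ^ j + y ^ j + z ^ j + (x + y + z) ^ j"
proof (induction j rule: less_induct)
  case (less j)
  have four: "(4::'a) = 0"
    using two by (metis mult_2 numeral_Bit0 add_0)
  consider "j = 0" | "j = 1" | "j = 2" | "j = 3" | i where "j = i + 4"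
  proof (cases "j < 4")
    case True
    then consider "j = 0" | "j = 1" | "j = 2" | "j = 3" by linarith
    with that show ?thesis by blast
  next
    case False
    hence "j = (j - 4) + 4" by simp
    with that show ?thesis by blast
  qed
  then show ?case
  proof cases
    case 1
    then show ?thesis using four by simp
  next
    case 2
    have "x + y + z + (x + y + z) = 2 * (x + y + z)" by (simp only: mult_2)
    with 2 two show ?thesis by simp
  next
    case 3
    have "x^2 + y^2 + z^2 + (x + y + z)^2 = 2 * (x^2 + y^2 + z^2 + x*y + x*z + y*z)"
      by (simp add: algebra_simps power2_eq_square power3_eq_cube)
    with 3 two show ?thesis by simp
  next
    case 4
    have "x^3 + y^3 + z^3 + (x + y + z)^3 = (x + y) * (x + z) * (y + z)
        + 2 * (x^3 + y^3 + z^3 + (x + y) * (x + z) * (y + z))"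
      by (simp add: algebra_simps power2_eq_square power3_eq_cube)
    with 4 two show ?thesis by simp
  next
    case (5 i)
    show ?thesis
      unfolding 5 power_sum_rec [OF refl two]
      by (intro dvd_add dvd_mult less.IH) (simp_all add: 5)
  qed
qed

lemma poly3_two_eq_0: "CHAR('a::comm_ring_1) = 2 \<Longrightarrow> (2 :: 'a poly3) = 0"
  using of_nat_CHAR [where 'a = "'a poly3"] by simp

lemma phi_pow_exact:
  assumes "CHAR('a::field) = 2"
  shows "phi_pow j * phi_denom = (X3 ^ j + Y3 ^ j + Z3 ^ j + (X3 + Y3 + Z3) ^ j :: 'a poly3)"
  using denom_dvd_power_sum [OF poly3_two_eq_0 [OF assms]]
  by (simp add: phi_pow_def phi_denom_def)

lemma subst3_eq_sum: "subst3 f p = (\<Sum>i\<le>degree f. const3 (coeff f i) * p ^ i)"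
proof -
  have "degree (map_poly const3 f) = degree f"
    by (rule degree_map_poly) (auto simp: const3_def)
  thus ?thesis
    by (simp add: subst3_def poly_altdef coeff_map_poly const3_def)
qed

lemma phi_poly_exact:
  assumes "CHAR('a::field) = 2"
  shows "phi_poly f * phi_denom =
    (subst3 f X3 + subst3 f Y3 + subst3 f Z3 + subst3 f (X3 + Y3 + Z3) :: 'a poly3)"
proof -
  have "phi_denom dvd
    (subst3 f X3 + subst3 f Y3 + subst3 f Z3 + subst3 f (X3 + Y3 + Z3) :: 'a poly3)"
    unfolding subst3_eq_sum sum.distrib [symmetric] distrib_left [symmetric] phi_denom_def
    by (intro dvd_sum dvd_mult denom_dvd_power_sum poly3_two_eq_0 assms)
  thus ?thesis
    by (simp add: phi_poly_def)
qed

end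

theory Submission
  imports Defs "HOL-Number_Theory.Residues"
begin

text \<open>
Put \<open>q = 2 ^ k\<close>, \<open>e = q\<^sup>2 - q + 1\<close> and \<open>d = deg h\<close>, and work over the algebraic closure. The proof rests on
\<open>q - 2\<close> rational curves of degree \<open>q + 1\<close> on the plane curve \<open>\<phi>\<^sub>e = 0\<close>. For \<open>a\<close> with \<open>a ^ q = a\<close> and
\<open>a \<noteq> 0, 1\<close>, the point
\<open>(x : y : z) = (1 : t ^ (q + 1) / (a (1 + a)) : (t + a) ^ (q + 1) / a)\<close> has
\<open>x + y + z = (t + 1 + a) ^ (q + 1) / (1 + a)\<close>. Since \<open>(q + 1) e = q\<^sup>3 + 1\<close> and the constants are fixed by
\<open>w \<mapsto> w ^ e\<close>, the same identity with \<open>q\<^sup>3\<close> for \<open>q\<close> says that the four \<open>e\<close>-th powers add up to zero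
(\<open>curve_power_sum\<close>).

Degrees. The curve meets the line \<open>y = 0\<close> at \<open>z = a\<close> with multiplicity \<open>q + 1\<close>. Hence a form that vanishes on the
curves of a set \<open>I\<close> and not on this line has degree at least \<open>(q + 1) card I\<close>
(\<open>degree_restrict_y0_ge\<close>); a form of smaller degree that vanishes on them is zero
(\<open>zero_if_curves_vanish\<close>). As \<open>\<phi>\<^sub>e\<close> has degree \<open>(q + 1) (q - 2)\<close>, in any factorisation
\<open>\<phi>\<^sub>e = A B\<close> each curve lies on exactly one factor, and the degree of a factor is exactly \<open>q + 1\<close>
times the number of curves on it (\<open>factor_degrees\<close>).

Multiplicities. All curves pass through \<open>(1 : 1 : 1)\<close>, with distinct tangents. A form that vanishes on the curves of
\<open>I\<close> therefore has multiplicity at least \<open>card I\<close> there (\<open>dvd_dilate_if_curves_vanish\<close>). On the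
other hand, \<open>\<phi>\<^sub>d\<close> has multiplicity at most \<open>2\<close> when \<open>d \<equiv> 5 (mod 8)\<close>
(\<open>not_dvd_dilate_phi_affine\<close>).

Conclusion (\<open>leading_factor_dvd\<close>). Let \<open>\<phi> = P Q\<close>, with leading forms \<open>A\<close> and \<open>B\<close>, so that
\<open>A B = \<phi>\<^sub>e\<close>. The next lower form in \<open>\<phi>\<close> is a nonzero multiple of \<open>\<phi>\<^sub>d\<close>, and it comes \<open>m = e - d\<close> degrees below the top.
Comparing homogeneous components and restricting to the curves shows that \<open>P\<close> and \<open>Q\<close> have no components strictly
between the top and \<open>m\<close> degrees below, whence \<open>A Q' + P' B = c \<phi>\<^sub>d\<close> for the components \<open>P'\<close>, \<open>Q'\<close> that
lie \<open>m\<close> degrees below. If \<open>A\<close> and \<open>B\<close> both contained three or more curves, \<open>\<phi>\<^sub>d\<close> would have multiplicity at least \<open>3\<close> at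
\<open>(1 : 1 : 1)\<close>. So one of them, say \<open>B\<close>, contains at most two and has degree at most \<open>2 (q + 1)\<close>. The bound on \<open>d\<close> says
\<open>2 (q + 1) < m\<close>; thus \<open>Q' = 0\<close> and \<open>B\<close> divides both \<open>\<phi>\<^sub>d\<close> and \<open>\<phi>\<^sub>e\<close>. As these are relatively prime
(\<open>common_divisor_degree_0\<close> carries this to the algebraic closure), \<open>B\<close> and hence \<open>Q\<close> is constant.

All forms are dehomogenised at \<open>x = 1\<close>; the homogeneous components of a polynomial are read off from the
substitution \<open>split_degrees\<close>.
\<close>

section \<open>Evaluation homomorphisms\<close>

text \<open>Bundling the ring homomorphism laws makes it possible to push one map through another: all the
substitutions below are evaluations of iterated polynomials in varying rings.\<close>
locale ring_map =
  fixes h :: "'r::comm_ring_1 \<Rightarrow> 's::comm_ring_1"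
  assumes add: "h (a + b) = h a + h b"
    and mult: "h (a * b) = h a * h b"
    and one: "h 1 = 1"
begin

lemma zero: "h 0 = 0"
  using add[of 0 0] by simp

lemma power: "h (a ^ n) = h a ^ n"
  by (induction n) (simp_all add: one mult)

lemma sum: "h (\<Sum>i\<in>S. f i) = (\<Sum>i\<in>S. h (f i))"
  by (induction S rule: infinite_finite_induct) (simp_all add: zero add)

lemma dvd: "a dvd b \<Longrightarrow> h a dvd h b"
  by (auto simp: mult elim!: dvdE)

end

lemma ring_map_comp:
  assumes "ring_map g" "ring_map h"
  shows "ring_map (\<lambda>a. g (h a))"
  using assms by (simp add: ring_map_def)

lemma ring_map_const_poly: "ring_map (\<lambda>c. [:c:])"
  by standard (simp_all add: one_pCons)

lemma ring_map_coeff_0: "ring_map (\<lambda>p. coeff p 0)"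
  by standard (simp_all add: coeff_mult)

lemma ring_map_to_ac: "ring_map to_ac"
  by standard simp_all

definition eval1 :: "('r::comm_ring_1 \<Rightarrow> 's::comm_ring_1) \<Rightarrow> 's \<Rightarrow> 'r poly \<Rightarrow> 's" where
  "eval1 h x p = poly (map_poly h p) x"

lemma eval1_pCons [simp]:
  assumes "ring_map h"
  shows "eval1 h x (pCons a p) = h a + x * eval1 h x p"
  by (simp add: eval1_def map_poly_pCons ring_map.zero[OF assms])

lemma eval1_0 [simp]: "eval1 h x 0 = 0"
  by (simp add: eval1_def)

lemma ring_map_eval1:
  assumes h: "ring_map h"
  shows "ring_map (eval1 h x)"
proof
  have add: "eval1 h x (p + r) = eval1 h x p + eval1 h x r" for p r
  proof (induction p arbitrary: r)
    case (pCons a p)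
    show ?case
      by (cases r) (use pCons in \<open>simp add: h ring_map.add[OF h] algebra_simps\<close>)
  qed simp
  show "eval1 h x (p + r) = eval1 h x p + eval1 h x r" for p r
    by (rule add)
  have smult: "eval1 h x (smult a r) = h a * eval1 h x r" for a r
    by (induction r) (simp_all add: h ring_map.mult[OF h] algebra_simps)
  show "eval1 h x (p * r) = eval1 h x p * eval1 h x r" for p r
    by (induction p) (simp_all add: h add smult ring_map.zero[OF h] algebra_simps)
  show "eval1 h x 1 = 1"
    by (simp add: one_pCons h ring_map.one[OF h])
qed

lemma ring_map_map_poly:
  assumes h: "ring_map h"
  shows "ring_map (map_poly h)"
proof -
  have "map_poly h = eval1 (\<lambda>a. [:h a:]) [:0, 1:]"
  proof
    show "map_poly h p = eval1 (\<lambda>a. [:h a:]) [:0, 1:] p" for p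
      by (induction p)
        (simp_all add: map_poly_pCons ring_map.zero[OF h] ring_map_comp[OF ring_map_const_poly h])
  qed
  thus ?thesis
    by (simp add: ring_map_eval1 ring_map_comp[OF ring_map_const_poly h])
qed

definition eval2 ::
  "('r::comm_ring_1 \<Rightarrow> 's::comm_ring_1) \<Rightarrow> 's \<Rightarrow> 's \<Rightarrow> 'r poly poly \<Rightarrow> 's" where
  "eval2 h y z = eval1 (eval1 h y) z"

lemma ring_map_eval2: "ring_map h \<Longrightarrow> ring_map (eval2 h y z)"
  by (simp add: eval2_def ring_map_eval1)

lemma eval1_natural:
  assumes g: "ring_map g" and h: "ring_map h"
  shows "g (eval1 h x p) = eval1 (\<lambda>a. g (h a)) (g x) p"
  by (induction p)
    (simp_all add: h ring_map_comp[OF g h] ring_map.zero[OF g] ring_map.add[OF g] ring_map.mult[OF g])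

text \<open>Two evaluations with the same effect on coefficients and variables agree; composites of
substitutions are computed with this rule.\<close>
lemma eval2_natural:
  assumes g: "ring_map g" and h: "ring_map h"
  shows "g (eval2 h y z p) = eval2 (\<lambda>a. g (h a)) (g y) (g z) p"
  unfolding eval2_def
  by (simp add: eval1_natural[OF g ring_map_eval1[OF h]] eval1_natural[OF g h])

text \<open>In \<open>K[y][z]\<close>, the coordinate ring of the affine plane, the outer variable is \<open>z\<close>.\<close>
abbreviation C2 :: "'a::comm_ring_1 \<Rightarrow> 'a poly poly" where "C2 c \<equiv> [:[:c:]:]"
definition Y2 :: "'a::comm_ring_1 poly poly" where "Y2 = [:[:0, 1:]:]"
definition Z2 :: "'a::comm_ring_1 poly poly" where "Z2 = [:0, 1:]"

lemma eval2_C2 [simp]: "ring_map h \<Longrightarrow> eval2 h y z (C2 c) = h c"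
  and eval2_Y2 [simp]: "ring_map h \<Longrightarrow> eval2 h y z Y2 = y"
  and eval2_Z2 [simp]: "ring_map h \<Longrightarrow> eval2 h y z Z2 = z"
  by (simp_all add: eval2_def Y2_def Z2_def ring_map_eval1 ring_map.zero ring_map.one ring_map.one[OF ring_map_eval1])

lemma ring_map_C2: "ring_map C2"
  by (intro ring_map_comp[OF ring_map_const_poly] ring_map_const_poly)

section \<open>Homogeneous components\<close>

text \<open>The substitution \<open>x \<mapsto> T\<close>, \<open>y \<mapsto> yT\<close>, \<open>z \<mapsto> zT\<close> from \<open>K[x][y][z]\<close> to \<open>K[y][z][T]\<close>. The coefficient of
\<open>T ^ i\<close> is the homogeneous component of degree \<open>i\<close>, dehomogenised at \<open>x = 1\<close>, so the degree in \<open>T\<close> is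
the total degree and its leading coefficient is the leading form.\<close>
definition split_degrees :: "'a::comm_ring_1 poly3 \<Rightarrow> 'a poly3" where
  "split_degrees = eval1 (eval1 (eval1 const3 [:0, 1:]) [:0, Y2:]) [:0, Z2:]"

lemma ring_map_const3: "ring_map const3"
  unfolding const3_def[abs_def]
  by (intro ring_map_comp[OF ring_map_const_poly] ring_map_const_poly)

lemma ring_map_split_degrees: "ring_map split_degrees"
  by (simp add: split_degrees_def ring_map_eval1 ring_map_const3)

lemma split_degrees_const3: "split_degrees (const3 c) = const3 c"
  and split_degrees_X3: "split_degrees X3 = [:0, 1:]"
  and split_degrees_Y3: "split_degrees Y3 = [:0, Y2:]"
  and split_degrees_Z3: "split_degrees Z3 = [:0, Z2:]"
  by (simp_all add: split_degrees_def const3_def[of c] X3_def Y3_def Z3_def ring_map_eval1 ring_map_const3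
      ring_map.zero[OF ring_map_const3] ring_map.one[OF ring_map_const3]
      ring_map.one[OF ring_map_eval1])

lemma coeff_const3:
  "coeff (coeff (coeff (const3 c) i) a) b = (if i = 0 \<and> a = 0 \<and> b = 0 then c else 0)"
  by (simp add: const3_def coeff_pCons split: nat.splits)

lemma coeff_split_degrees_x:
  "coeff (coeff (coeff (eval1 const3 [:0, 1:] p) i) a) b =
    (if a = 0 \<and> b = 0 then coeff p i else 0)"
proof (induction p arbitrary: i)
  case (pCons c p)
  show ?case
    by (cases i) (simp_all add: pCons ring_map_const3 coeff_const3)
qed simp

lemma coeff_Y2_mult: "coeff (coeff (Y2 * w) a) b = (case b of 0 \<Rightarrow> 0 | Suc b' \<Rightarrow> coeff (coeff w a) b')"
  and coeff_Z2_mult: "coeff (Z2 * w) a = (case a of 0 \<Rightarrow> 0 | Suc a' \<Rightarrow> coeff w a')"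
  by (simp_all add: Y2_def Z2_def coeff_pCons split: nat.splits)

lemma coeff_split_degrees_xy:
  "coeff (coeff (coeff (eval1 (eval1 const3 [:0, 1:]) [:0, Y2:] p) i) a) b =
    (if a = 0 \<and> b \<le> i then coeff (coeff p b) (i - b) else 0)"
proof (induction p arbitrary: i b)
  case (pCons c p)
  show ?case
    by (cases i; cases b)
     (simp_all add: pCons ring_map_const3 ring_map_eval1 coeff_split_degrees_x coeff_Y2_mult)
qed simp

lemma coeff_split_degrees:
  "coeff (coeff (coeff (split_degrees p) i) a) b =
    (if a + b \<le> i then coeff (coeff (coeff p a) b) (i - a - b) else 0)"
  unfolding split_degrees_def
proof (induction p arbitrary: i a)
  case (pCons c p)
  show ?case
    by (cases i; cases a)
     (simp_all add: pCons ring_map_const3 ring_map_eval1 coeff_split_degrees_xy coeff_Z2_mult)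
qed simp

text \<open>A form of degree \<open>i\<close> has degree at most \<open>i\<close> in \<open>z\<close>. After setting \<open>x = 1\<close> the argument uses homogeneity
only through this bound.\<close>
lemma degree_coeff_split_degrees: "degree (coeff (split_degrees p) i) \<le> i"
  by (rule degree_le) (auto simp: poly_eq_iff coeff_split_degrees)

lemma coeff_of_coeff_split_degrees:
  "coeff (coeff (coeff p a) b) c = coeff (coeff (coeff (split_degrees p) (a + b + c)) a) b"
  by (simp add: coeff_split_degrees)

lemma split_degrees_eq_0_iff: "split_degrees p = 0 \<longleftrightarrow> p = 0"
  by (auto simp: poly_eq_iff coeff_of_coeff_split_degrees[of p]) (simp add: coeff_split_degrees)

lemma is_unit_of_degree_split_degrees:
  fixes p :: "'a::field poly3"
  assumes "p \<noteq> 0" "degree (split_degrees p) = 0"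
  shows "is_unit p"
proof -
  have coeffs: "coeff (coeff (coeff p a) b) c = 0" if "a + b + c > 0" for a b c
    using that assms(2) by (simp add: coeff_of_coeff_split_degrees coeff_eq_0)
  have "p = const3 (coeff (coeff (coeff p 0) 0) 0)"
    by (auto simp: const3_def poly_eq_iff coeff_pCons intro!: coeffs split: nat.splits)
  then obtain c where "p = const3 c" by blast
  with assms(1) show ?thesis
    by (auto simp: const3_def is_unit_poly_iff dvd_field_iff)
qed

lemma degree_split_degrees_unit:
  fixes p :: "'a::field poly3"
  assumes "is_unit p"
  shows "degree (split_degrees p) = 0"
  using ring_map.dvd[OF ring_map_split_degrees assms]
  by (simp add: ring_map.one[OF ring_map_split_degrees] is_unit_poly_iff)
    (auto)

section \<open>Characteristic two\<close>

lemma char2_add_self: "(2::'r::comm_ring_1) = 0 \<Longrightarrow> a + a = (0::'r)"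
  using mult_2[of a] by simp

lemma char2_uminus: "(2::'r::comm_ring_1) = 0 \<Longrightarrow> - a = (a::'r)"
  using char2_add_self[of a] by (simp add: minus_unique)

text \<open>Stated from \<open>2 = 0\<close> rather than from a characteristic, so that it applies to polynomial and power
series rings over the field without further ado.\<close>
lemma char2_power_add:
  fixes a b :: "'r::comm_ring_1"
  assumes "(2::'r) = 0"
  shows "(a + b) ^ (2 ^ m) = a ^ (2 ^ m) + b ^ (2 ^ m)"
proof (induction m)
  case (Suc m)
  have "(a + b) ^ (2 ^ Suc m) = (a ^ (2 ^ m) + b ^ (2 ^ m)) ^ 2"
    by (simp add: power_mult mult.commute[of 2] Suc)
  also have "\<dots> = (a ^ (2 ^ m)) ^ 2 + (b ^ (2 ^ m)) ^ 2"
    using assms by (simp add: power2_sum)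
  finally show ?case
    by (simp add: mult.commute[of 2] flip: power_mult)
qed simp

lemma poly_char2: "(2::'r::comm_ring_1) = 0 \<Longrightarrow> (2::'r poly) = 0"
  by (simp add: numeral_poly)

section \<open>The polynomials in the chart x = 1\<close>

definition power_sum_affine :: "nat \<Rightarrow> 'a::comm_ring_1 poly poly" where
  "power_sum_affine j = 1 + Y2 ^ j + Z2 ^ j + (1 + Y2 + Z2) ^ j"

definition denom_affine :: "'a::comm_ring_1 poly poly" where
  "denom_affine = (1 + Y2) * (1 + Z2) * (Y2 + Z2)"

definition phi_affine :: "nat \<Rightarrow> 'a::field poly poly" where
  "phi_affine j = power_sum_affine j div denom_affine"

lemma phi_affine_denom_affine:
  assumes "(2::'a::field) = 0"
  shows "phi_affine j * denom_affine = (power_sum_affine j :: 'a poly poly)"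
  using denom_dvd_power_sum[OF poly_char2[OF poly_char2[OF assms]], of 1 Y2 Z2 j]
  by (simp add: phi_affine_def power_sum_affine_def denom_affine_def)

definition restrict_y0 :: "'a::comm_ring_1 poly poly \<Rightarrow> 'a poly" where
  "restrict_y0 = map_poly (\<lambda>r. coeff r 0)"

lemma ring_map_restrict_y0: "ring_map restrict_y0"
  unfolding restrict_y0_def by (intro ring_map_map_poly ring_map_coeff_0)

lemma degree_restrict_y0_le: "degree (restrict_y0 W) \<le> degree W"
  unfolding restrict_y0_def by (rule map_poly_degree_leq)

lemma coeff_restrict_y0: "coeff (restrict_y0 W) i = coeff (coeff W i) 0"
  by (simp add: restrict_y0_def coeff_map_poly)

text \<open>A double root is a root of the derivative.\<close>
lemma rsquarefree_if_separable:
  fixes p :: "'a::field poly"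
  assumes "\<And>a. poly p a = 0 \<Longrightarrow> poly (pderiv p) a \<noteq> 0" and p: "p \<noteq> 0"
  shows "rsquarefree p"
proof -
  have "order a p < 2" for a
  proof (rule ccontr)
    assume "\<not> order a p < 2"
    hence "[:-a, 1:] ^ 2 dvd p"
      by (simp add: order_divides)
    then obtain g where "p = [:-a, 1:] ^ 2 * g"
      by (elim dvdE)
    hence "p = [:-a, 1:] * ([:-a, 1:] * g)"
      by (simp only: power2_eq_square mult.assoc)
    hence "poly p a = 0" "poly (pderiv p) a = 0"
      by (simp_all only: pderiv_mult poly_add poly_mult) simp_all
    with assms show False by blast
  qed
  thus ?thesis
    using p by (auto simp: rsquarefree_def less_2_cases_iff)
qed

lemma card_alg_closed_roots:
  fixes p :: "'a::alg_closed_field poly"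
  assumes "rsquarefree p"
  shows "card {x. poly p x = 0} = degree p"
proof -
  have p: "p \<noteq> 0" using assms by (simp add: rsquarefree_def)
  obtain A where A: "size A = degree p" "p = smult (lead_coeff p) (\<Prod>x\<in>#A. [:-x, 1:])"
    using alg_closed_imp_factorization[OF p] by blast
  have nz: "(\<Prod>x\<in>#B. [:-x, 1:]) \<noteq> (0::'a poly)" for B
    by (auto simp: prod_mset_zero_iff)
  have "proots (\<Prod>x\<in>#A. [:-x, 1:]) = A"
  proof (induction A)
    case (add x A)
    have "proots ([:-x, 1:] * (\<Prod>x\<in>#A. [:-x, 1:])) = add_mset x A"
      by (subst proots_mult) (use nz[of A] add in simp_all)
    thus ?case by (simp del: mult_pCons_left)
  qed simp
  hence "proots p = A"
    using p by (subst A(2)) simp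
  moreover have "proots p = mset_set {x. poly p x = 0}"
  proof (rule multiset_eqI)
    fix a
    have "order a p = (if poly p a = 0 then 1 else 0)"
      using assms p unfolding rsquarefree_def by (auto simp: order_root dest: spec[of _ a])
    thus "count (proots p) a = count (mset_set {x. poly p x = 0}) a"
      using p by (simp add: count_mset_set' poly_roots_finite)
  qed
  ultimately show ?thesis using A(1) by (metis size_mset_set)
qed

text \<open>The derivative at \<open>0\<close> is \<open>n\<close>, which is odd. For \<open>n = e\<close> this is the restriction of a power sum to the
line \<open>y = 0\<close>; for \<open>n = 5\<close> it is the leading form at \<open>(1 : 1 : 1)\<close>.\<close>
lemma one_power_sum_ne_0:
  assumes two: "(2::'a::idom) = 0" and n: "odd n" "n > 1"
  shows "1 + [:0, 1:] ^ n + (1 + [:0, 1:]) ^ n \<noteq> (0 :: 'a poly)"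
proof
  assume "1 + [:0, 1:] ^ n + (1 + [:0, 1:]) ^ n = (0 :: 'a poly)"
  hence "poly (pderiv (1 + [:0, 1:] ^ n + (1 + [:0, 1:]) ^ n :: 'a poly)) 0 = 0"
    by (simp only: pderiv_0 poly_0)
  hence "(of_nat n :: 'a) = 0"
    using n(2) by (simp add: pderiv_add pderiv_power pderiv_pCons power_0_left)
  moreover obtain c where "n = 2 * c + 1"
    using n(1) by (elim oddE)
  ultimately show False
    using two by simp
qed

section \<open>Rational curves on the Kasami polynomial\<close>

text \<open>The exponent is \<open>e = q\<^sup>2 - q + 1\<close>, written without subtraction.\<close>
locale kasami =
  fixes K :: "'k::alg_closed_field itself" and k q e :: nat
  assumes two: "(2::'k) = 0" and q: "q = 2 ^ k" and k: "k \<ge> 2" and e: "e + q = q ^ 2 + 1"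
begin

definition params :: "'k set" where
  "params = {a. a ^ q = a \<and> a \<noteq> 0 \<and> a \<noteq> 1}"

lemma paramsD: "a \<in> params \<Longrightarrow> a ^ q = a \<and> a \<noteq> 0 \<and> 1 + a \<noteq> 0"
  using char2_uminus[OF two, of a] by (auto simp: params_def add_eq_0_iff)

lemma q_ge: "q \<ge> 4"
  using power_increasing[of 2 k "2::nat"] k by (simp add: q)

lemma frobenius: "((a::'k) + b) ^ q = a ^ q + b ^ q"
  unfolding q by (rule char2_power_add[OF two])

lemma two_poly: "(2 :: 'k poly) = 0"
  by (rule poly_char2[OF two])

text \<open>This is where the Kasami exponent enters: the power map \<open>w \<mapsto> w ^ e\<close> turns the \<open>(q + 1)\<close>-st
powers that parametrise the curves into \<open>(q\<^sup>3 + 1)\<close>-st powers.\<close>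
lemma exponents: "(q + 1) * e = q ^ 3 + 1"
proof -
  have "(q + 1) * (e + q) = (q + 1) * (q ^ 2 + 1)" by (simp only: e)
  thus ?thesis by (simp add: algebra_simps power2_eq_square power3_eq_cube)
qed

lemma power_e:
  assumes "(b::'k) ^ q = b"
  shows "b ^ e = b" "b ^ (q ^ 3) = b"
proof -
  have q2: "b ^ (q ^ 2) = b"
    by (simp add: power2_eq_square power_mult assms)
  show "b ^ (q ^ 3) = b"
    by (simp add: power3_eq_cube power_mult assms)
  show "b ^ e = b"
  proof (cases "b = 0")
    case True
    have "e \<noteq> 0"
      using exponents by (metis add_is_0 mult_0_right one_neq_zero)
    with True show ?thesis by simp
  next
    case False
    have "b ^ e * b = b ^ (e + q)"
      by (simp add: power_add assms)
    also have "\<dots> = b * b"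
      by (simp add: e power_add q2)
    finally show ?thesis using False by simp
  qed
qed

text \<open>The curve with parameter \<open>a\<close> is
\<open>(x : y : z : x + y + z) = (1 : t ^ (q + 1) / (a (1 + a)) : (t + a) ^ (q + 1) / a : (t + 1 + a) ^ (q + 1) / (1 + a))\<close>.
It comes from a line on the Hermitian surface: after the substitution of \<open>(q + 1)\<close>-st powers, the
condition \<open>x + y + z + w = 0\<close> says that the point lies on the surface, and the vanishing of the power
sum of exponent \<open>e\<close> then says that it spans with its image under the \<open>q\<^sup>2\<close>-Frobenius map a line
contained in the surface.\<close>
definition curve_y :: "'k \<Rightarrow> 'k poly" where
  "curve_y a = smult (1 / (a * (1 + a))) ([:0, 1:] ^ (q + 1))"

definition curve_z :: "'k \<Rightarrow> 'k poly" where
  "curve_z a = smult (1 / a) ([:a, 1:] ^ (q + 1))"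

text \<open>The pullback of a function on the plane to the curve with parameter \<open>a\<close>.\<close>
definition curve :: "'k \<Rightarrow> 'k poly poly \<Rightarrow> 'k poly" where
  "curve a = eval2 (\<lambda>c. [:c:]) (curve_y a) (curve_z a)"

lemma ring_map_curve: "ring_map (curve a)"
  unfolding curve_def by (intro ring_map_eval2 ring_map_const_poly)

lemma curve_Y2: "curve a Y2 = curve_y a" and curve_Z2: "curve a Z2 = curve_z a"
  by (simp_all only: curve_def eval2_Y2[OF ring_map_const_poly] eval2_Z2[OF ring_map_const_poly])

text \<open>For \<open>m\<close>-fold Frobenius \<open>u = t ^ (2 ^ m)\<close>, which fixes \<open>a\<close>, this is the identity
\<open>a (1 + a) + u t + (1 + a) (u + a) (t + a) + a (u + 1 + a) (t + 1 + a) = 0\<close>. It is used twice: for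
\<open>2 ^ m = q\<close> it identifies the fourth coordinate of the curve, and for \<open>2 ^ m = q\<^sup>3\<close> it shows that the
curve lies on the Kasami polynomial.\<close>
lemma curve_sum_zero:
  fixes a :: 'k
  assumes a: "a ^ (2 ^ m) = a" "a \<noteq> 0" "1 + a \<noteq> 0"
  shows "1 + smult (1 / (a * (1 + a))) ([:0, 1:] ^ (2 ^ m + 1)) + smult (1 / a) ([:a, 1:] ^ (2 ^ m + 1))
    + smult (1 / (1 + a)) ([:1 + a, 1:] ^ (2 ^ m + 1)) = 0" (is "?L = 0")
proof -
  have lin: "[:b, 1:] ^ (2 ^ m + 1) = ([:0, 1:] ^ (2 ^ m) + [:b:]) * ([:0, 1:] + [:b:])"
    if "b ^ (2 ^ m) = b" for b :: 'k
  proof -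
    have "[:b, 1:] = [:0, 1:] + [:b:]" by simp
    hence "[:b, 1:] ^ (2 ^ m + 1) = ([:0, 1:] + [:b:]) ^ (2 ^ m) * ([:0, 1:] + [:b:])"
      by (simp only: power_add power_one_right)
    also have "([:0, 1:] + [:b:]) ^ (2 ^ m) = [:0, 1:] ^ (2 ^ m) + [:b:] ^ (2 ^ m)"
      by (rule char2_power_add[OF two_poly])
    finally show ?thesis
      by (simp add: poly_const_pow that)
  qed
  have a1: "(1 + a) ^ (2 ^ m) = 1 + a"
    using a by (simp add: char2_power_add[OF two])
  define t u A :: "'k poly" where "t = [:0, 1:]" and "u = [:0, 1:] ^ (2 ^ m)" and "A = [:a:]"
  have A1: "[:1 + a:] = 1 + A"
    by (simp add: A_def one_pCons)
  have smult_A: "smult a p = A * p" "smult (1 + a) p = (1 + A) * p"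
    "smult (a * (1 + a)) p = A * (1 + A) * p" for p
    by (simp_all add: A_def smult_add_left algebra_simps)
  have "smult (a * (1 + a)) ?L = smult (a * (1 + a)) 1 + [:0, 1:] ^ (2 ^ m + 1)
      + smult (1 + a) ([:a, 1:] ^ (2 ^ m + 1)) + smult a ([:1 + a, 1:] ^ (2 ^ m + 1))"
    using a by (simp only: smult_add_right smult_smult) simp
  also have "\<dots> = A * (1 + A) * 1 + u * t + (1 + A) * ((u + A) * (t + A))
      + A * ((u + (1 + A)) * (t + (1 + A)))"
    unfolding lin[OF a(1)] lin[OF a1] A1 smult_A
    unfolding t_def u_def A_def by (simp only: power_add power_one_right)
  \<comment> \<open>After expansion every monomial occurs an even number of times.\<close>
  also have "\<dots> = 2 * (A + 2 * A * A + u * t + u * A + A * t + A * u * t + u * A * A + A * A * t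
      + A * A * A)"
    by (simp add: algebra_simps)
  also have "\<dots> = 0"
    by (simp add: two_poly)
  finally show ?thesis
    using a by simp
qed

text \<open>Raising the coordinates to the power \<open>e\<close> replaces the exponent \<open>q + 1\<close> by \<open>q\<^sup>3 + 1\<close> and keeps the
constants, because they are fixed by the Frobenius map.\<close>
lemma curve_power_sum:
  assumes "a \<in> params"
  shows "curve a (power_sum_affine e) = 0"
proof -
  note a = paramsD[OF assms]
  have a1: "(1 + a) ^ q = 1 + a"
    using a by (simp add: frobenius)
  have m: "q = 2 ^ k" "q ^ 3 = 2 ^ (3 * k)"
    by (simp_all add: q mult.commute flip: power_mult)
  have "1 + curve_y a + curve_z a + smult (1 / (1 + a)) ([:1 + a, 1:] ^ (q + 1)) = 0"
    unfolding curve_y_def curve_z_def unfolding m(1) by (rule curve_sum_zero) (use a m in auto)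
  hence w: "1 + curve_y a + curve_z a = smult (1 / (1 + a)) ([:1 + a, 1:] ^ (q + 1))"
    using char2_uminus[OF two_poly] by (metis eq_neg_iff_add_eq_0)
  have pw: "(smult (1 / b) (p ^ (q + 1))) ^ e = smult (1 / b) (p ^ (q ^ 3 + 1))"
    if "b ^ q = b" for b and p :: "'k poly"
    by (simp only: smult_power power_mult[symmetric] exponents power_divide power_e(1)[OF that] power_one)
  have "curve a (power_sum_affine e) = 1 + curve_y a ^ e + curve_z a ^ e + (1 + curve_y a + curve_z a) ^ e"
    unfolding power_sum_affine_def
    by (simp only: ring_map.add[OF ring_map_curve] ring_map.power[OF ring_map_curve]
        ring_map.one[OF ring_map_curve] curve_Y2 curve_Z2)
  also have "\<dots> = 1 + smult (1 / (a * (1 + a))) ([:0, 1:] ^ (q ^ 3 + 1)) + smult (1 / a) ([:a, 1:] ^ (q ^ 3 + 1))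
      + smult (1 / (1 + a)) ([:1 + a, 1:] ^ (q ^ 3 + 1))"
  proof -
    have "(a * (1 + a)) ^ q = a * (1 + a)"
      using a a1 by (simp add: power_mult_distrib)
    thus ?thesis
      unfolding w unfolding curve_y_def curve_z_def
      using pw[of "a * (1 + a)" "[:0, 1:]"] pw[of a "[:a, 1:]"] pw[of "1 + a" "[:1 + a, 1:]"] a a1
      by (simp only: simp_thms)
  qed
  also have "\<dots> = 0"
    unfolding m(2) by (rule curve_sum_zero) (use a power_e(2)[of a] m(2) in auto)
  finally show ?thesis .
qed

lemma poly_curve_z_0: "a \<in> params \<Longrightarrow> poly (curve_z a) 0 = a"
  by (simp add: curve_z_def) (metis paramsD nonzero_eq_divide_eq)

lemma curve_denom_affine: 
  assumes "a \<in> params"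
  shows "curve a denom_affine \<noteq> 0"
proof -
  note a = paramsD[OF assms]
  have "poly (curve a denom_affine) 0 = (1 + a) * a"
    unfolding denom_affine_def
    by (simp add: ring_map.add[OF ring_map_curve] ring_map.mult[OF ring_map_curve]
        ring_map.one[OF ring_map_curve] curve_Y2 curve_Z2 poly_curve_z_0[OF assms]) (simp add: curve_y_def)
  with a show ?thesis by auto
qed

lemma curve_phi_affine:
  assumes "a \<in> params"
  shows "curve a (phi_affine e) = 0"
proof -
  have "curve a (phi_affine e) * curve a denom_affine = 0"
    by (simp add: curve_power_sum[OF assms] phi_affine_denom_affine[OF two] flip: ring_map.mult[OF ring_map_curve])
  with curve_denom_affine[OF assms] show ?thesis by simp
qed

text \<open>Along the curve the \<open>y\<close>-coordinate vanishes to order \<open>q + 1\<close> at \<open>t = 0\<close>, so up to that order a function on the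
plane may be replaced by its restriction to the line \<open>y = 0\<close>.\<close>
lemma curve_minus_restrict_y0:
  "[:0, 1:] ^ (q + 1) dvd curve a W - eval1 (\<lambda>c. [:c:]) (curve_z a) (restrict_y0 W)"
proof (induction W)
  case (pCons r W)
  have r: "[:0, 1:] ^ (q + 1) dvd eval1 (\<lambda>c. [:c:]) (curve_y a) r - [:coeff r 0:]"
    by (cases r) (simp add: ring_map_const_poly curve_y_def dvd_smult del: power_Suc)
  have eq: "curve a (pCons r W) - eval1 (\<lambda>c. [:c:]) (curve_z a) (restrict_y0 (pCons r W)) =
      (eval1 (\<lambda>c. [:c:]) (curve_y a) r - [:coeff r 0:]) + curve_z a * (curve a W - eval1 (\<lambda>c. [:c:]) (curve_z a) (restrict_y0 W))"
    by (simp add: curve_def eval2_def ring_map_const_poly ring_map_eval1 restrict_y0_def map_poly_pCons algebra_simps)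
  show ?case unfolding eq by (intro dvd_add dvd_mult r pCons.IH)
qed (simp add: curve_def eval2_def restrict_y0_def)

text \<open>At \<open>t = 0\<close> the function \<open>z - a\<close> is a local parameter on the curve.\<close>
lemma curve_z_minus_const:
  assumes "a \<in> params"
  obtains u where "curve_z a = [:a:] + [:0, 1:] * u" "poly u 0 = 1"
proof -
  note a = paramsD[OF assms]
  have "[:a, 1:] ^ q = [:0, 1:] ^ q + [:a:]"
  proof -
    have "[:a, 1:] ^ q = ([:0, 1:] + [:a:]) ^ q" by simp
    also have "\<dots> = [:0, 1:] ^ q + [:a:] ^ q"
      unfolding q by (rule char2_power_add[OF two_poly])
    finally show ?thesis using a by (simp add: poly_const_pow)
  qed
  hence "curve_z a = smult (1 / a) (([:0, 1:] ^ q + [:a:]) * ([:0, 1:] + [:a:]))"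
    by (simp add: curve_z_def power_add)
  also have "[:0, 1:] ^ q = [:0, 1:] * ([:0, 1:] ^ (q - 1) :: 'k poly)"
    using q_ge by (simp flip: power_Suc)
  finally have "curve_z a = [:a:] + [:0, 1:] * (smult (1 / a) ([:0, 1:] ^ (q - 1) * [:a, 1:]) + 1)"
    using a by (simp add: algebra_simps smult_add_right)
  moreover have "poly (smult (1 / a) ([:0, 1:] ^ (q - 1) * [:a, 1:]) + 1) 0 = 1"
    using q_ge by (simp add: power_0_left)
  ultimately show ?thesis by (rule that)
qed

text \<open>The curve meets the line \<open>y = 0\<close> at \<open>z = a\<close> with multiplicity \<open>q + 1\<close>, while \<open>z\<close> is a local parameter
there.\<close>
lemma order_restrict_y0:
  assumes a: "a \<in> params" and W: "curve a W = 0" "restrict_y0 W \<noteq> 0"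
  shows "q + 1 \<le> order a (restrict_y0 W)"
proof (rule ccontr)
  define ev where "ev = eval1 (\<lambda>c. [:c:]) (curve_z a)"
  have ev: "ring_map ev"
    unfolding ev_def by (intro ring_map_eval1 ring_map_const_poly)
  assume "\<not> ?thesis"
  hence n: "order a (restrict_y0 W) < q + 1" by simp
  obtain g where g: "restrict_y0 W = [:-a, 1:] ^ order a (restrict_y0 W) * g" and g0: "\<not> [:-a, 1:] dvd g"
    using order_decomp[OF W(2)] by blast
  define n where "n = order a (restrict_y0 W)"
  obtain u where u: "curve_z a = [:a:] + [:0, 1:] * u" "poly u 0 = 1"
    using curve_z_minus_const[OF a] .
  \<comment> \<open>The factor \<open>(z - a) ^ n\<close> contributes exactly \<open>n\<close> to the order in \<open>t\<close>, and \<open>g\<close> contributes nothing.\<close>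
  have lin: "ev [:-a, 1:] = [:0, 1:] * u"
    by (simp add: ev_def ring_map_const_poly u(1) ring_map.one[OF ev, unfolded ev_def])
  have "ev (restrict_y0 W) = [:0, 1:] ^ n * (u ^ n * ev g)"
    by (subst g) (simp only: ring_map.mult[OF ev] ring_map.power[OF ev] lin power_mult_distrib
        n_def mult.assoc)
  moreover have "[:0, 1:] ^ (q + 1) dvd ev (restrict_y0 W)"
    using curve_minus_restrict_y0[of a W] W by (simp add: ev_def)
  moreover have "[:0, 1:] ^ (n + 1) dvd ([:0, 1:] ^ (q + 1) :: 'k poly)"
    using n by (intro le_imp_power_dvd) (simp add: n_def)
  ultimately have "[:0, 1:] ^ n * [:0, 1:] dvd [:0, 1:] ^ n * (u ^ n * ev g)"
    by (metis dvd_trans power_add power_one_right)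
  moreover have "[:0, 1:] ^ n \<noteq> (0 :: 'k poly)"
    by simp
  ultimately have "[:0, 1:] dvd u ^ n * ev g"
    by (metis dvd_times_left_cancel_iff)
  hence "poly (u ^ n * ev g) 0 = 0"
    by (simp only: poly_eq_0_iff_dvd minus_zero)
  moreover have "poly (ev g) 0 = poly g (poly (curve_z a) 0)"
    by (induction g) (simp_all add: ev_def ring_map_const_poly)
  ultimately have "poly g a = 0"
    by (simp add: u(2) poly_curve_z_0[OF a])
  with g0 show False by (simp add: poly_eq_0_iff_dvd)
qed

text \<open>Distinct curves meet the line \<open>y = 0\<close> in distinct points, so the contributions add up.\<close>
lemma degree_restrict_y0_ge:
  assumes I: "I \<subseteq> params" "\<And>a. a \<in> I \<Longrightarrow> curve a W = 0" and W: "restrict_y0 W \<noteq> 0"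
  shows "(q + 1) * card I \<le> degree (restrict_y0 W)"
proof -
  have ord: "q + 1 \<le> order a (restrict_y0 W)" if "a \<in> I" for a
    using order_restrict_y0[of a W] I W that by auto
  have "(q + 1) * card I = (\<Sum>a\<in>I. q + 1)" by simp
  also have "\<dots> \<le> (\<Sum>a\<in>I. order a (restrict_y0 W))"
    by (intro sum_mono ord)
  also have "\<dots> \<le> (\<Sum>a | poly (restrict_y0 W) a = 0. order a (restrict_y0 W))"
    using ord W by (intro sum_mono2 poly_roots_finite) (fastforce simp: order_root)+
  also have "\<dots> \<le> degree (restrict_y0 W)"
    by (rule sum_order_le_degree[OF W])
  finally show ?thesis .
qed

text \<open>By the degree bound the restriction to \<open>y = 0\<close> is zero; divide by \<open>y\<close>, which does not vanish on the
curves, and repeat. This is what kills the components of a factor below its leading form.\<close>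
lemma zero_if_curves_vanish:
  assumes I: "I \<subseteq> params" and W: "\<And>a. a \<in> I \<Longrightarrow> curve a W = 0"
    and deg: "degree W < (q + 1) * card I"
  shows "W = 0"
proof -
  have "coeff (coeff V i) n = 0"
    if "\<And>a. a \<in> I \<Longrightarrow> curve a V = 0" "degree V < (q + 1) * card I" for V i n
    using that
  proof (induction n arbitrary: V i)
    case (0 V i)
    have "restrict_y0 V = 0"
      using degree_restrict_y0_ge[OF I "0.prems"(1)] degree_restrict_y0_le[of V] "0.prems"(2) by fastforce
    thus ?case by (simp flip: coeff_restrict_y0)
  next
    case (Suc n V i)
    have V0: "coeff (coeff V i) 0 = 0" for i
      using degree_restrict_y0_ge[OF I Suc.prems(1)] degree_restrict_y0_le[of V] Suc.prems(2) coeff_restrict_y0[of V i]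
      by fastforce
    \<comment> \<open>All coefficients of \<open>V\<close> vanish at \<open>y = 0\<close>, so \<open>V = y V'\<close>.\<close>
    define V' where "V' = map_poly (poly_shift 1) V"
    have coeff_V': "coeff V' i = poly_shift 1 (coeff V i)" for i
      by (simp add: V'_def coeff_map_poly)
    have V: "V = Y2 * V'"
      by (auto simp: poly_eq_iff coeff_V' coeff_Y2_mult coeff_poly_shift V0 split: nat.splits)
    have "curve a V' = 0" if "a \<in> I" for a
    proof -
      have "curve_y a * curve a V' = 0"
        using Suc.prems(1)[OF that]
        by (subst (asm) V) (simp add: ring_map.mult[OF ring_map_curve] curve_Y2)
      moreover have "curve_y a \<noteq> 0"
        using I that paramsD[of a] by (auto simp: curve_y_def)
      ultimately show ?thesis by simp
    qed
    moreover have "degree V' < (q + 1) * card I"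
      using Suc.prems(2) map_poly_degree_leq[of "poly_shift 1" V] by (simp add: V'_def)
    ultimately have "coeff (coeff V' i) n = 0"
      by (rule Suc.IH)
    thus ?case by (simp add: coeff_V' coeff_poly_shift)
  qed
  with W deg show ?thesis by (auto simp: poly_eq_iff)
qed

lemma odd_e: "odd e"
  using e q k by (metis even_add even_power even_plus_one_iff dvd_refl pos2 order.strict_trans2)

lemma restrict_y0_phi_affine: "restrict_y0 (phi_affine e :: 'k poly poly) \<noteq> 0"
proof
  assume "restrict_y0 (phi_affine e :: 'k poly poly) = 0"
  hence "restrict_y0 (power_sum_affine e :: 'k poly poly) = 0"
    by (simp add: ring_map.mult[OF ring_map_restrict_y0] flip: phi_affine_denom_affine[OF two])
  moreover have "restrict_y0 (power_sum_affine e :: 'k poly poly) = 1 + [:0, 1:] ^ e + (1 + [:0, 1:]) ^ e"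
  proof -
    have Y: "restrict_y0 (Y2 :: 'k poly poly) = 0" and Z: "restrict_y0 (Z2 :: 'k poly poly) = [:0, 1:]"
      by (auto simp: poly_eq_iff coeff_restrict_y0 Y2_def Z2_def coeff_pCons split: nat.splits)
    have "0 ^ e = (0 :: 'k poly)"
      using odd_e by (auto intro: ccontr)
    thus ?thesis
      unfolding power_sum_affine_def
      by (simp only: ring_map.add[OF ring_map_restrict_y0] ring_map.power[OF ring_map_restrict_y0]
        ring_map.one[OF ring_map_restrict_y0] Y Z add_0_right)
  qed
  moreover have "e > 1"
  proof -
    have "q * 4 \<le> q ^ 2" using q_ge by (simp add: power2_eq_square)
    thus ?thesis using e q_ge by linarith
  qed
  ultimately show False
    using one_power_sum_ne_0[OF two odd_e] by simp
qed

lemma card_params: "finite params" "card params = q - 2"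
proof -
  define p :: "'k poly" where "p = monom 1 q + [:0, 1:]"
  have p_root: "poly p a = 0 \<longleftrightarrow> a ^ q = a" for a
    by (auto simp: p_def poly_monom add_eq_0_iff char2_uminus[OF two])
  have deg: "degree p = q"
    using q_ge by (simp add: p_def degree_add_eq_left degree_monom_eq)
  have "(of_nat q :: 'k) = 0"
    using k two by (simp add: q)
  \<comment> \<open>Apart from \<open>0\<close> and \<open>1\<close>, the parameters are the roots of \<open>p\<close>, which is separable.\<close>
  hence "pderiv p = 1"
    by (simp add: p_def pderiv_add pderiv_monom pderiv_pCons one_pCons)
  hence "rsquarefree p"
    using q_ge deg by (intro rsquarefree_if_separable) auto
  hence card: "card {a::'k. a ^ q = a} = q"
    using card_alg_closed_roots[of p] by (simp add: p_root deg)
  hence fin: "finite {a::'k. a ^ q = a}"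
    using q_ge by (intro card_ge_0_finite) simp
  have params: "params = {a. a ^ q = a} - {0, 1}"
    by (auto simp: params_def)
  show "finite params" unfolding params using fin by simp
  have "{0, 1} \<subseteq> {a::'k. a ^ q = a}"
    using q_ge by (simp add: power_0_left)
  thus "card params = q - 2"
    unfolding params by (subst card_Diff_subset) (simp_all add: card)
qed

end

section \<open>Multiplicity at the point (1 : 1 : 1)\<close>

text \<open>The substitution \<open>y \<mapsto> 1 + \<epsilon>\<close>, \<open>z \<mapsto> 1 + \<lambda>\<epsilon>\<close> restricts to the pencil of lines through \<open>(1 : 1 : 1)\<close>; here \<open>\<epsilon>\<close>
is \<open>Z2\<close> and the slope \<open>\<lambda>\<close> is \<open>Y2\<close>. The multiplicity at that point is the order in \<open>\<epsilon>\<close>, and the first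
nonzero coefficient is the tangent cone as a polynomial in the slope.\<close>
definition dilate :: "'a::comm_ring_1 poly poly \<Rightarrow> 'a poly poly" where
  "dilate = eval2 C2 (1 + Z2) (1 + Y2 * Z2)"

lemma ring_map_dilate: "ring_map dilate"
  unfolding dilate_def by (intro ring_map_eval2 ring_map_C2)

lemma dilate_Y2: "dilate Y2 = 1 + Z2" and dilate_Z2: "dilate Z2 = 1 + Y2 * Z2"
  by (simp_all add: dilate_def ring_map_C2)

lemma degree_coeff_eval1_le:
  assumes h: "ring_map h" and hd: "\<And>a n. degree (coeff (h a) n) \<le> n"
    and x: "\<And>n. degree (coeff x n) \<le> n"
  shows "degree (coeff (eval1 h x p :: 'a::comm_ring_1 poly poly) n) \<le> n"
proof (induction p arbitrary: n)
  case (pCons a p)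
  have "degree (coeff (x * eval1 h x p) n) \<le> n"
    unfolding coeff_mult
  proof (intro degree_sum_le)
    fix i assume "i \<in> {..n}"
    thus "degree (coeff x i * coeff (eval1 h x p) (n - i)) \<le> n"
      using degree_mult_le[of "coeff x i" "coeff (eval1 h x p) (n - i)"] x[of i] pCons.IH[of "n - i"]
      by simp
  qed simp
  thus ?case using hd[of a n] by (simp add: h degree_add_le)
qed simp

text \<open>The part of order \<open>n\<close> is a binary form of degree \<open>n\<close>, so it has at most \<open>n\<close> roots as a polynomial in the slope.\<close>
lemma degree_coeff_dilate: "degree (coeff (dilate W) n) \<le> n"
  unfolding dilate_def eval2_def
  by (intro degree_coeff_eval1_le ring_map_eval1 ring_map_C2)
    (auto simp: Y2_def Z2_def one_pCons coeff_pCons split: nat.splits)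

text \<open>Modulo \<open>T ^ 8\<close> the eighth power of \<open>1 + uT\<close> is \<open>1\<close>, so only the exponent modulo \<open>8\<close> matters.\<close>
lemma coeff_linear_power_char2:
  fixes u :: "'a::comm_ring_1"
  assumes two: "(2::'a) = 0"
  shows "coeff ([:1, u:] ^ (8 * j + 5)) 5 = u ^ 5"
proof -
  have "[:1, u:] ^ 8 = (1 + [:0, u:]) ^ (2 ^ 3)"
    by (simp add: one_pCons)
  also have "\<dots> = 1 + [:0, u:] ^ 8"
    using char2_power_add[OF poly_char2[OF two], of 1 "[:0, u:]" 3] by simp
  finally have p8: "[:1, u:] ^ 8 = 1 + [:0, u:] ^ 8" .
  have monom: "[:0, u:] ^ 8 = monom (u ^ 8) 8"
    using monom_power[of u 1 8] by (simp add: monom_altdef)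
  have "coeff (([:1, u:] ^ 8) ^ j * p) 5 = coeff p 5" for p
  proof (induction j)
    case (Suc j)
    have "([:1, u:] ^ 8) ^ Suc j * p = ([:1, u:] ^ 8) ^ j * p + monom (u ^ 8) 8 * (([:1, u:] ^ 8) ^ j * p)"
      unfolding power_Suc by (simp only: p8 monom) (simp add: algebra_simps)
    with Suc show ?case by (simp add: coeff_monom_mult)
  qed simp
  hence "coeff ([:1, u:] ^ (8 * j + 5)) 5 = coeff ([:1, u:] ^ 5) 5"
    by (simp add: power_add power_mult)
  also have "\<dots> = u ^ 5"
    by (simp add: coeff_linear_poly_power)
  finally show ?thesis .
qed

lemma Z2_power_dvd_iff: "Z2 ^ n dvd W \<longleftrightarrow> (\<forall>i<n. coeff W i = 0)"
proof -
  have "Z2 ^ n = monom (1 :: 'a::comm_ring_1 poly) n"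
    by (simp add: Z2_def monom_altdef)
  thus ?thesis using monom_1_dvd_iff'[of n W] by simp
qed

text \<open>For \<open>d \<equiv> 5 (mod 8)\<close> the power sum has the leading form \<open>1 + \<lambda> ^ 5 + (1 + \<lambda>) ^ 5\<close> of degree \<open>5\<close> at the point
\<open>(1 : 1 : 1)\<close>, and the denominator takes away \<open>3\<close>. So the multiplicity there is at most \<open>2\<close>.\<close>
lemma not_dvd_dilate_phi_affine:
  assumes two: "(2::'a::field) = 0" and d: "d mod 8 = 5"
  shows "\<not> Z2 ^ 3 dvd dilate (phi_affine d :: 'a poly poly)"
proof
  define u :: "'a poly" where "u = [:0, 1:]"
  have two': "(2::'a poly) = 0" "(2::'a poly poly) = 0"
    using two by (simp_all add: poly_char2)
  assume "Z2 ^ 3 dvd dilate (phi_affine d :: 'a poly poly)"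
  moreover have "Z2 ^ 3 dvd dilate (denom_affine :: 'a poly poly)"
  proof -
    have "dilate (denom_affine :: 'a poly poly) = (2 + Z2) * (2 + Y2 * Z2) * (2 + Z2 * (1 + Y2))"
      unfolding denom_affine_def
      by (simp only: ring_map.add[OF ring_map_dilate] ring_map.mult[OF ring_map_dilate]
          ring_map.one[OF ring_map_dilate] dilate_Y2 dilate_Z2) (simp add: algebra_simps)
    also have "\<dots> = Z2 ^ 3 * (Y2 * (1 + Y2))"
      by (simp add: two' power3_eq_cube algebra_simps)
    finally show ?thesis by simp
  qed
  ultimately have "Z2 ^ 3 * Z2 ^ 3 dvd dilate (phi_affine d) * dilate (denom_affine :: 'a poly poly)"
    by (rule mult_dvd_mono)
  also have "dilate (phi_affine d) * dilate (denom_affine :: 'a poly poly) = dilate (power_sum_affine d)"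
    by (simp add: phi_affine_denom_affine[OF two] flip: ring_map.mult[OF ring_map_dilate])
  finally have "Z2 ^ 6 dvd dilate (power_sum_affine d :: 'a poly poly)"
    by (simp flip: power_add)
  hence "coeff (dilate (power_sum_affine d :: 'a poly poly)) 5 = 0"
    by (simp add: Z2_power_dvd_iff)
  moreover have "dilate (power_sum_affine d :: 'a poly poly) = 1 + [:1, 1:] ^ d + [:1, u:] ^ d + [:1, 1 + u:] ^ d"
  proof -
    have "1 + (1 + Z2) + (1 + Y2 * Z2) = (2 + [:1, 1 + u:] :: 'a poly poly)"
      "1 + Z2 = [:1, 1 :: 'a poly:]" "1 + Y2 * Z2 = [:1, u:]"
      by (simp_all add: Y2_def Z2_def u_def one_pCons numeral_poly)
    thus ?thesis
      unfolding power_sum_affine_def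
      by (simp only: ring_map.add[OF ring_map_dilate] ring_map.power[OF ring_map_dilate]
          ring_map.one[OF ring_map_dilate] dilate_Y2 dilate_Z2 two' add_0_left)
  qed
  moreover have "d = 8 * (d div 8) + 5"
    using d by presburger
  then obtain j where "d = 8 * j + 5" ..
  ultimately have "1 + u ^ 5 + (1 + u) ^ 5 = 0"
    by (simp add: coeff_linear_power_char2[OF two'(1)] del: power_Suc)
  moreover have "1 + u ^ 5 + (1 + u) ^ 5 \<noteq> 0"
    unfolding u_def by (rule one_power_sum_ne_0[OF two]) simp_all
  ultimately show False by contradiction
qed

lemma ring_map_fps_const: "ring_map fps_const"
  by standard simp_all

lemma ring_map_fps_nth_0: "ring_map (\<lambda>f. fps_nth f 0)"
  by standard (simp_all add: fps_mult_nth)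

lemma eval1_id: "eval1 (\<lambda>c. c) x p = poly p x"
  by (simp add: eval1_def)

context kasami
begin

text \<open>Square roots of parameters, as powers of them. The curve passes through \<open>(1 : 1 : 1)\<close> in the direction
\<open>\<lambda> = 1 + \<surd>a\<close>.\<close>
definition sqrt_param :: "'k \<Rightarrow> 'k" where
  "sqrt_param a = a ^ (2 ^ (k - 1))"

lemma sqrt_param:
  assumes "a \<in> params"
  shows "sqrt_param a ^ 2 = a" "sqrt_param a ^ q = sqrt_param a"
proof -
  note a = paramsD[OF assms]
  have "2 ^ (k - 1) * 2 = q"
    using k by (simp add: q flip: power_Suc2)
  thus "sqrt_param a ^ 2 = a"
    using a by (simp add: sqrt_param_def flip: power_mult)
  show "sqrt_param a ^ q = sqrt_param a"
    using a by (simp add: sqrt_param_def mult.commute flip: power_mult) (simp add: power_mult)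
qed

text \<open>Near a point \<open>c\<close> fixed by the Frobenius map, \<open>(c + X) ^ (q + 1) = (c + X) (c + X ^ q)\<close> is \<open>c\<^sup>2 + cX\<close> up to
higher order. Both coordinates of a curve have this shape.\<close>
lemma norm_fps_expansion:
  assumes c: "c ^ q = c" "c \<noteq> (0::'k)"
  obtains f where "fps_const (1 / c ^ 2) * (fps_const c + fps_X) ^ (q + 1) = 1 + fps_X * f"
    "fps_nth f 0 = 1 / c"
proof -
  have two_fps: "(2 :: 'k fps) = 0"
    by (simp add: numeral_fps_const two)
  define x :: "'k fps" where "x = fps_X"
  have xq: "x ^ q = x * x ^ (q - 1)"
    using q_ge by (simp flip: power_Suc)
  have "(fps_const c + x) ^ (q + 1) = (fps_const c + x) ^ q * (fps_const c + x)"
    by simp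
  also have "(fps_const c + x) ^ q = fps_const c + x ^ q"
    unfolding q using char2_power_add[OF two_fps, of "fps_const c" x k] c by (simp add: q)
  finally have "fps_const (1 / c ^ 2) * (fps_const c + x) ^ (q + 1) =
      fps_const (1 / c ^ 2) * fps_const c * fps_const c + x * (fps_const (1 / c ^ 2) * (fps_const c + x ^ (q - 1) * (fps_const c + x)))"
    unfolding xq by (simp only: algebra_simps)
  also have "fps_const (1 / c ^ 2) * fps_const c * fps_const c = 1"
    using c by (simp add: power2_eq_square)
  finally have *: "fps_const (1 / c ^ 2) * (fps_const c + fps_X) ^ (q + 1) =
     1 + fps_X * (fps_const (1 / c ^ 2) * (fps_const c + fps_X ^ (q - 1) * (fps_const c + fps_X)))"
    by (simp only: x_def)
  show ?thesis
    by (rule that[OF *]) (use c q_ge in \<open>simp add: power2_eq_square fps_X_power_iff fps_mult_nth\<close>)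
qed

text \<open>With \<open>b = \<surd>a\<close>, the parameter value \<open>t = b + b\<^sup>2\<close> is mapped to \<open>(1 : 1 : 1)\<close>, since \<open>t\<^sup>2 = a (1 + a)\<close> and
\<open>(t + a)\<^sup>2 = b\<^sup>2 = a\<close>. Expanding there gives \<open>y = 1 + E\<close> and \<open>z = 1 + E L\<close> for power series \<open>E\<close>, \<open>L\<close>, that is, the
curve is \<open>\<epsilon> = E\<close>, \<open>\<lambda> = L\<close> in the coordinates of \<^const>\<open>dilate\<close>, with slope \<open>L(0) = t / b = 1 + b\<close>.\<close>
lemma curve_local:
  assumes a: "a \<in> params"
  obtains E L where "E \<noteq> 0" "fps_nth E 0 = 0" "fps_nth L 0 = 1 + sqrt_param a"
    "\<And>W. curve a W = 0 \<Longrightarrow> eval2 fps_const L E (dilate W) = 0"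
proof -
  define b where "b = sqrt_param a"
  define t where "t = b + b ^ 2"
  note b = sqrt_param[OF a, folded b_def] and a' = paramsD[OF a]
  have t_q: "t ^ q = t"
    by (simp add: t_def frobenius power_mult[symmetric]) (simp add: mult.commute power_mult b)
  have b0: "b \<noteq> 0"
    using b a' by auto
  have t_sq: "t ^ 2 = a * (1 + a)"
    using two by (simp add: t_def power2_sum b) (simp add: power2_eq_square algebra_simps)
  hence t0: "t \<noteq> 0" using a' by auto
  define S where "S = eval1 fps_const (fps_const t + fps_X)"
  have S: "ring_map S"
    unfolding S_def by (intro ring_map_eval1 ring_map_fps_const)
  have S_lin: "S [:c, 1:] = fps_const (c + t) + fps_X" and S_const: "S [:c:] = fps_const c" for c
    by (simp_all add: S_def ring_map_fps_const flip: fps_const_add)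
  obtain c1 where c1: "fps_const (1 / t ^ 2) * (fps_const t + fps_X) ^ (q + 1) = 1 + fps_X * c1"
    "fps_nth c1 0 = 1 / t"
    using norm_fps_expansion[OF t_q t0] .
  obtain c2 where c2: "fps_const (1 / b ^ 2) * (fps_const b + fps_X) ^ (q + 1) = 1 + fps_X * c2"
    "fps_nth c2 0 = 1 / b"
    using norm_fps_expansion[OF b(2) b0] .
  have S_smult: "S (smult c p) = fps_const c * S p" for c p
    using ring_map.mult[OF S, of "[:c:]" p] by (simp add: S_const)
  have "S (curve_y a) = 1 + fps_X * c1"
    unfolding curve_y_def S_smult ring_map.power[OF S] S_lin c1(1)[symmetric] t_sq by simp
  moreover have "a + t = b"
    using char2_add_self[OF two] by (simp add: t_def b add.left_commute)
  hence "S (curve_z a) = 1 + fps_X * c2"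
    unfolding curve_z_def S_smult ring_map.power[OF S] S_lin c2(1)[symmetric] b(1) by simp
  moreover define E where "E = fps_X * c1"
  moreover define L where "L = c2 * inverse c1"
  moreover have "c1 * inverse c1 = 1"
    by (rule inverse_mult_eq_1') (use c1(2) t0 in simp)
  hence "E * L = fps_X * c2"
    by (simp add: E_def L_def mult_ac)
  ultimately have S_curve: "S (curve_y a) = 1 + E" "S (curve_z a) = 1 + E * L"
    by simp_all
  show ?thesis
  proof
    show "E \<noteq> 0" using c1(2) t0 by (auto simp: E_def)
    show "fps_nth E 0 = 0" by (simp add: E_def)
    have "fps_nth L 0 = t / b"
      using c1(2) c2(2) by (simp add: L_def fps_mult_nth)
    thus "fps_nth L 0 = 1 + sqrt_param a"
      using b0 by (simp add: t_def b_def[symmetric] power2_eq_square add_divide_distrib)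
    fix W assume W: "curve a W = 0"
    have "eval2 fps_const L E (dilate W) = eval2 fps_const (1 + E) (1 + E * L) W"
      unfolding dilate_def
      by (simp only: eval2_natural[OF ring_map_eval2[OF ring_map_fps_const] ring_map_C2]
        eval2_C2 eval2_Y2 eval2_Z2 ring_map_fps_const ring_map.add[OF ring_map_eval2[OF ring_map_fps_const]]
        ring_map.mult[OF ring_map_eval2[OF ring_map_fps_const]]
        ring_map.one[OF ring_map_eval2[OF ring_map_fps_const]] mult.commute[of E])
    also have "\<dots> = S (curve a W)"
      unfolding curve_def eval2_natural[OF S ring_map_const_poly] S_const S_curve ..
    finally show "eval2 fps_const L E (dilate W) = 0"
      by (simp add: W ring_map.zero[OF S])
  qed
qed

text \<open>The tangent cone vanishes in the direction of every curve contained in the zero set, and these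
directions are distinct. A tangent cone of degree \<open>n < card I\<close> would therefore be zero.\<close>
lemma dvd_dilate_if_curves_vanish:
  assumes I: "I \<subseteq> params" "\<And>a. a \<in> I \<Longrightarrow> curve a W = 0"
  shows "Z2 ^ card I dvd dilate W"
  unfolding Z2_power_dvd_iff
proof (intro allI impI)
  fix n assume "n < card I"
  thus "coeff (dilate W) n = 0"
  proof (induction n rule: less_induct)
    case (less n)
    hence "Z2 ^ n dvd dilate W"
      by (auto simp: Z2_power_dvd_iff)
    then obtain M where M: "dilate W = Z2 ^ n * M" by (elim dvdE)
    have M0: "coeff (dilate W) n = coeff M 0"
      using coeff_monom_mult[of 1 n M n] by (simp add: M Z2_def monom_altdef)
    have "poly (coeff M 0) (1 + sqrt_param a) = 0" if "a \<in> I" for a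
    proof -
      have a: "a \<in> params" using I that by auto
      obtain E L where LE: "E \<noteq> 0" "fps_nth E 0 = 0" "fps_nth L 0 = 1 + sqrt_param a"
        and vanish: "\<And>V. curve a V = 0 \<Longrightarrow> eval2 fps_const L E (dilate V) = 0"
        using curve_local[OF a] by blast
      have "E ^ n * eval2 fps_const L E M = 0"
        using vanish[OF I(2)[OF that]] by (simp add: M ring_map_fps_const ring_map.mult[OF ring_map_eval2[OF ring_map_fps_const]]
          ring_map.power[OF ring_map_eval2[OF ring_map_fps_const]])
      hence "fps_nth (eval2 fps_const L E M) 0 = 0"
        using LE(1) by simp
      moreover have "fps_nth (eval2 fps_const L E M) 0 = eval1 (\<lambda>c. poly c (1 + sqrt_param a)) 0 M"
        using eval2_natural[OF ring_map_fps_nth_0 ring_map_fps_const, of L E M] LE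
        by (simp add: eval2_def eval1_id[abs_def])
      moreover have "eval1 (\<lambda>c. poly c (1 + sqrt_param a)) 0 M = poly (coeff M 0) (1 + sqrt_param a)"
        by (simp add: eval1_def coeff_map_poly poly_0_coeff_0)
      ultimately show ?thesis by simp
    qed
    hence sub: "(\<lambda>a. 1 + sqrt_param a) ` I \<subseteq> {x. poly (coeff M 0) x = 0}"
      by auto
    have inj: "inj_on (\<lambda>a. 1 + sqrt_param a) I"
      using I(1) sqrt_param(1) by (intro inj_onI) (metis add_left_cancel subsetD)
    show ?case
    proof (rule ccontr)
      assume "coeff (dilate W) n \<noteq> 0"
      hence nz: "coeff M 0 \<noteq> 0" by (simp add: M0)
      have "card I = card ((\<lambda>a. 1 + sqrt_param a) ` I)"
        by (simp add: card_image inj)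
      also have "\<dots> \<le> card {x. poly (coeff M 0) x = 0}"
        by (intro card_mono sub poly_roots_finite nz)
      also have "\<dots> \<le> degree (coeff M 0)"
        by (rule card_poly_roots_bound[OF nz])
      also have "\<dots> \<le> n"
        using degree_coeff_dilate[of W n] by (simp add: M0)
      finally show False using less.prems by simp
    qed
  qed
qed

end

section \<open>Eliminating a variable from coprime polynomials\<close>

text \<open>
Polynomial rings over a field \<open>F\<close> are factorial, and the proof of elimination below needs greatest common
divisors in \<open>F[x][y]\<close> as well as in the polynomial ring over its field of fractions. Equipping every
field of fractions with its trivial gcd structure serves both purposes, because \<open>F\<close> is isomorphic to
its own field of fractions.\<close>
instantiation fract :: (idom)
  "{unique_euclidean_ring, normalization_euclidean_semiring, normalization_semidom_multiplicative}"
begin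

definition [simp]: "normalize_fract = (normalize_field :: 'a fract \<Rightarrow> _)"
definition [simp]: "unit_factor_fract = (unit_factor_field :: 'a fract \<Rightarrow> _)"
definition [simp]: "modulo_fract = (mod_field :: 'a fract \<Rightarrow> _)"
definition [simp]: "euclidean_size_fract = (euclidean_size_field :: 'a fract \<Rightarrow> _)"
definition [simp]: "division_segment (x :: 'a fract) = 1"

instance
  by standard (simp_all add: dvd_field_iff field_split_simps split: if_splits)

end

instantiation fract :: (idom) euclidean_ring_gcd
begin

definition gcd_fract :: "'a fract \<Rightarrow> 'a fract \<Rightarrow> 'a fract" where
  "gcd_fract = Euclidean_Algorithm.gcd"
definition lcm_fract :: "'a fract \<Rightarrow> 'a fract \<Rightarrow> 'a fract" where
  "lcm_fract = Euclidean_Algorithm.lcm"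
definition Gcd_fract :: "'a fract set \<Rightarrow> 'a fract" where
  "Gcd_fract = Euclidean_Algorithm.Gcd"
definition Lcm_fract :: "'a fract set \<Rightarrow> 'a fract" where
  "Lcm_fract = Euclidean_Algorithm.Lcm"

instance
  by standard (simp_all add: gcd_fract_def lcm_fract_def Gcd_fract_def Lcm_fract_def)

end

instance fract :: (idom) field_gcd ..

text \<open>By Gauss's lemma coprime polynomials stay coprime over the field of fractions; there they satisfy a
Bezout identity, and clearing denominators leaves a nonzero constant.\<close>
lemma coprime_elimination_factorial:
  fixes f g :: "'r::{factorial_ring_gcd, semiring_gcd_mult_normalize} poly"
  assumes "coprime f g"
  shows "\<exists>u v r. r \<noteq> 0 \<and> u * f + v * g = [:r:]"
proof -
  have "coprime (fract_poly f) (fract_poly g)"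
  proof (rule coprimeI)
    fix c assume c: "c dvd fract_poly f" "c dvd fract_poly g"
    show "is_unit c"
    proof (cases "c = 0")
      case True
      with c have "f = 0" "g = 0" by simp_all
      with assms show ?thesis by simp
    next
      case False
      define p where "p = primitive_part_fract c"
      have c_eq: "c = smult (fract_content c) (fract_poly p)"
        by (simp add: p_def content_times_primitive_part_fract)
      have content: "content p = 1"
        using False by (simp add: p_def)
      \<comment> \<open>The primitive part of a common divisor divides both polynomials already before extension.\<close>
      have "fract_poly p dvd c"
        by (subst c_eq) (rule dvd_smult, rule dvd_refl)
      hence "p dvd f" "p dvd g"
        using c content by (meson fract_poly_dvdD dvd_trans)+
      hence "is_unit p" using assms by (metis coprime_common_divisor)
      hence "is_unit (fract_poly p)"
        by (rule fract_poly_is_unit)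
      thus ?thesis
        using False by (subst c_eq) (simp add: is_unit_smult_iff dvd_field_iff)
    qed
  qed
  hence gcd1: "gcd (fract_poly f) (fract_poly g) = 1"
    by simp
  obtain x y where "x * fract_poly f + y * fract_poly g = 1"
    using bezout_coefficients_fst_snd[of "fract_poly f" "fract_poly g"] unfolding gcd1 by blast
  moreover obtain a x' where x: "x = smult a (fract_poly x')"
    using content_decompose_fract[of x] by metis
  moreover obtain b y' where y: "y = smult b (fract_poly y')"
    using content_decompose_fract[of y] by metis
  moreover obtain a1 a2 where a: "a = to_fract a1 / to_fract a2" "a2 \<noteq> 0"
    using Fract_conv_to_fract by (metis Fract_cases)
  moreover obtain b1 b2 where b: "b = to_fract b1 / to_fract b2" "b2 \<noteq> 0"
    using Fract_conv_to_fract by (metis Fract_cases)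
  ultimately have "smult (to_fract (a2 * b2)) (smult a (fract_poly x') * fract_poly f +
      smult b (fract_poly y') * fract_poly g) = smult (to_fract (a2 * b2)) 1"
    by simp
  hence "fract_poly (smult (a1 * b2) x' * f + smult (b1 * a2) y' * g) = fract_poly [:a2 * b2:]"
    using a b by (simp add: smult_add_right one_pCons map_poly_pCons mult_ac)
  hence "smult (a1 * b2) x' * f + smult (b1 * a2) y' * g = [:a2 * b2:]"
    by (simp only: fract_poly_eq_iff)
  with a b show ?thesis
    by (metis mult_eq_0_iff)
qed

definition map_poly3 :: "('a::comm_ring_1 \<Rightarrow> 'b::comm_ring_1) \<Rightarrow> 'a poly3 \<Rightarrow> 'b poly3" where
  "map_poly3 h = map_poly (map_poly (map_poly h))"

lemma ring_map_map_poly3: "ring_map h \<Longrightarrow> ring_map (map_poly3 h)"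
  by (simp add: map_poly3_def ring_map_map_poly)

lemma map_poly3_map_poly3:
  assumes "ring_map g" "ring_map h"
  shows "map_poly3 g (map_poly3 h p) = map_poly3 (\<lambda>a. g (h a)) p"
  using assms
  by (simp add: map_poly3_def map_poly_map_poly ring_map.zero ring_map_map_poly o_def)

lemma map_poly3_id: "map_poly3 (\<lambda>a. a) p = p"
proof -
  have id: "map_poly (\<lambda>a. a) = (\<lambda>s :: 'c::zero poly. s)" by auto
  show ?thesis by (simp add: map_poly3_def id)
qed

lemma ring_map_to_fract: "ring_map to_fract"
  by standard simp_all

text \<open>The same for coefficients in \<open>F[x][y]\<close> over an arbitrary field \<open>F\<close>, transported along the isomorphism
between \<open>F\<close> and its field of fractions.\<close>
lemma coprime_elimination:
  fixes f g :: "'a::field poly3"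
  assumes "coprime f g"
  shows "\<exists>u v r. r \<noteq> 0 \<and> u * f + v * g = [:r:]"
proof -
  define h :: "'a fract \<Rightarrow> 'a" where "h = (\<lambda>x. SOME a. to_fract a = x)"
  have "x \<in> range to_fract" for x :: "'a fract"
  proof -
    obtain a b where "x = Fract a b" "b \<noteq> 0" by (cases x)
    hence "x = to_fract (a / b)"
      by (simp add: to_fract_def eq_fract)
    thus ?thesis by blast
  qed
  hence ex: "\<exists>a. to_fract a = x" for x :: "'a fract"
    by (metis rangeE)
  have to_fract_h: "to_fract (h x) = x" for x
    unfolding h_def by (rule someI_ex[OF ex])
  have h_to_fract: "h (to_fract a) = a" for a
    using to_fract_h[of "to_fract a"] by simp
  have h: "ring_map h"
  proof
    show "h (x + y) = h x + h y" "h (x * y) = h x * h y" for x y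
      by (simp_all flip: to_fract_eq_iff add: to_fract_h)
    show "h 1 = 1" by (simp flip: to_fract_eq_iff add: to_fract_h)
  qed
  note maps = ring_map_map_poly3[OF h] ring_map_map_poly3[OF ring_map_to_fract]
  have inverse: "map_poly3 h (map_poly3 to_fract p) = p" "map_poly3 to_fract (map_poly3 h s) = s" for p s
    by (simp_all add: map_poly3_map_poly3 h ring_map_to_fract h_to_fract to_fract_h map_poly3_id)
  have "coprime (map_poly3 to_fract f) (map_poly3 to_fract g)"
  proof (rule coprimeI)
    fix c assume "c dvd map_poly3 to_fract f" "c dvd map_poly3 to_fract g"
    hence "map_poly3 h c dvd f" "map_poly3 h c dvd g"
      using ring_map.dvd[OF maps(1)] inverse by metis+
    hence "is_unit (map_poly3 h c)"
      using assms by (metis coprime_common_divisor)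
    thus "is_unit c"
      using ring_map.dvd[OF maps(2)] inverse ring_map.one[OF maps(2)] by metis
  qed
  then obtain u v r where r: "r \<noteq> 0" "u * map_poly3 to_fract f + v * map_poly3 to_fract g = [:r:]"
    using coprime_elimination_factorial by blast
  have "map_poly3 h u * f + map_poly3 h v * g = map_poly3 h [:r:]"
    by (simp add: ring_map.add[OF maps(1)] ring_map.mult[OF maps(1)] inverse flip: r(2))
  also have eq: "map_poly3 h [:r:] = [:map_poly (map_poly h) r:]"
    by (simp add: map_poly3_def map_poly_pCons)
  finally have "map_poly3 h u * f + map_poly3 h v * g = [:map_poly (map_poly h) r:]" .
  moreover have "map_poly (map_poly h) r \<noteq> 0"
  proof
    assume "map_poly (map_poly h) r = 0"
    hence "map_poly3 h [:r:] = 0" by (simp add: eq)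
    hence "[:r:] = 0"
      using inverse(2)[of "[:r:]"] ring_map.zero[OF maps(2)] by metis
    with r(1) show False by simp
  qed
  ultimately show ?thesis by blast
qed

section \<open>Homogeneous components of the quotient polynomials\<close>

lemma denom_affine_neq_0: "(denom_affine :: 'a::field poly poly) \<noteq> 0"
  by (simp add: denom_affine_def Y2_def Z2_def one_pCons)

definition split_degrees_ac :: "'a::field poly3 \<Rightarrow> 'a alg_closure poly3" where
  "split_degrees_ac p = split_degrees (map_poly3 to_ac p)"

lemma ring_map_split_degrees_ac: "ring_map split_degrees_ac"
  unfolding split_degrees_ac_def[abs_def]
  by (rule ring_map_comp[OF ring_map_split_degrees ring_map_map_poly3[OF ring_map_to_ac]])

lemma split_degrees_ac_const3: "split_degrees_ac (const3 (c :: 'a::field)) = const3 (to_ac c)"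
  and split_degrees_ac_X3: "split_degrees_ac (X3 :: 'a poly3) = [:0, 1:]"
  and split_degrees_ac_Y3: "split_degrees_ac (Y3 :: 'a poly3) = [:0, Y2:]"
  and split_degrees_ac_Z3: "split_degrees_ac (Z3 :: 'a poly3) = [:0, Z2:]"
proof -
  have "map_poly3 to_ac (const3 c) = const3 (to_ac c)" "map_poly3 to_ac (X3 :: 'a poly3) = X3"
    "map_poly3 to_ac (Y3 :: 'a poly3) = Y3" "map_poly3 to_ac (Z3 :: 'a poly3) = Z3"
    by (simp_all add: map_poly3_def const3_def X3_def Y3_def Z3_def map_poly_pCons)
  thus "split_degrees_ac (const3 c) = const3 (to_ac c)" "split_degrees_ac (X3 :: 'a poly3) = [:0, 1:]"
    "split_degrees_ac (Y3 :: 'a poly3) = [:0, Y2:]" "split_degrees_ac (Z3 :: 'a poly3) = [:0, Z2:]"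
    by (simp_all add: split_degrees_ac_def split_degrees_const3 split_degrees_X3 split_degrees_Y3 split_degrees_Z3)
qed

lemma monom_1_power: "[:0, w:] ^ j = monom (w ^ j) j" for w :: "'a::comm_ring_1"
  using monom_power[of w 1 j] by (simp add: monom_altdef)

text \<open>The homogeneous component of degree \<open>i\<close> comes from the monomial of degree \<open>i + 3\<close>, because the
denominator is a form of degree \<open>3\<close>.\<close>
lemma coeff_split_degrees_ac_phi_poly:
  fixes f :: "'a::field poly"
  assumes char: "CHAR('a) = 2"
  shows "coeff (split_degrees_ac (phi_poly f)) i = C2 (to_ac (coeff f (i + 3))) * phi_affine (i + 3)"
proof -
  note R = ring_map_split_degrees_ac
  have two: "(2 :: 'a alg_closure) = 0"
    using of_nat_CHAR[where 'a = "'a alg_closure"] char by simp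
  have lin: "split_degrees_ac (X3 + Y3 + Z3 :: 'a poly3) = [:0, 1 + Y2 + Z2:]"
    by (simp add: ring_map.add[OF R] split_degrees_ac_X3 split_degrees_ac_Y3 split_degrees_ac_Z3)
  have subst: "split_degrees_ac (subst3 f p) = (\<Sum>j\<le>degree f. monom (C2 (to_ac (coeff f j)) * w ^ j) j)"
    if "split_degrees_ac p = [:0, w:]" for p w
    unfolding subst3_eq_sum
    by (simp add: ring_map.sum[OF R] ring_map.mult[OF R] ring_map.power[OF R] split_degrees_ac_const3
        that monom_1_power) (simp add: const3_def smult_monom)
  have "split_degrees_ac (phi_poly f) * split_degrees_ac phi_denom =
      (\<Sum>j\<le>degree f. monom (C2 (to_ac (coeff f j)) * power_sum_affine j) j)"
    unfolding ring_map.mult[OF R, symmetric] phi_poly_exact[OF char]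
    by (simp add: ring_map.add[OF R] subst[OF split_degrees_ac_X3] subst[OF split_degrees_ac_Y3]
        subst[OF split_degrees_ac_Z3] subst[OF lin] power_sum_affine_def distrib_left sum.distrib flip: add_monom)
  moreover have "split_degrees_ac (phi_denom :: 'a poly3) = monom denom_affine 3"
  proof -
    have "split_degrees_ac (phi_denom :: 'a poly3) = [:0, 1 + Y2:] * [:0, 1 + Z2:] * [:0, Y2 + Z2:]"
      by (simp add: phi_denom_def ring_map.add[OF R] ring_map.mult[OF R] split_degrees_ac_X3
          split_degrees_ac_Y3 split_degrees_ac_Z3)
    also have "\<dots> = monom (1 + Y2) 1 * monom (1 + Z2) 1 * monom (Y2 + Z2) 1"
      by (simp only: monom_1_power[of _ 1, unfolded power_one_right])
    also have "\<dots> = monom denom_affine 3"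
      by (simp add: mult_monom denom_affine_def eval_nat_numeral)
    finally show ?thesis .
  qed
  ultimately have "coeff (split_degrees_ac (phi_poly f) * monom denom_affine 3) (i + 3) =
      coeff (\<Sum>j\<le>degree f. monom (C2 (to_ac (coeff f j)) * power_sum_affine j) j) (i + 3)"
    by simp
  also have "\<dots> = C2 (to_ac (coeff f (i + 3))) * power_sum_affine (i + 3)"
    by (auto simp: coeff_sum coeff_eq_0 if_distrib[of "coeff _"] cong: if_cong)
  also have "\<dots> = C2 (to_ac (coeff f (i + 3))) * phi_affine (i + 3) * denom_affine"
    by (simp add: phi_affine_denom_affine[OF two] mult.assoc)
  finally have "coeff (split_degrees_ac (phi_poly f)) i * denom_affine =
      C2 (to_ac (coeff f (i + 3))) * phi_affine (i + 3) * denom_affine"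
    using coeff_monom_mult[of denom_affine 3 "split_degrees_ac (phi_poly f)" "i + 3"] by (simp add: mult.commute)
  thus ?thesis
    by (simp only: mult_right_cancel[OF denom_affine_neq_0])
qed

lemma subst3_monom: "subst3 (monom 1 j) (p :: 'a::comm_ring_1 poly3) = p ^ j"
proof -
  have "subst3 (monom 1 j) p = eval1 const3 p ([:0, 1:] ^ j)"
    by (simp add: subst3_def eval1_def monom_1_power)
  also have "eval1 const3 p ([:0, 1:] ^ j) = p ^ j"
    by (simp only: ring_map.power[OF ring_map_eval1[OF ring_map_const3]])
      (simp add: ring_map_const3 ring_map.zero[OF ring_map_const3] ring_map.one[OF ring_map_const3]
        ring_map.one[OF ring_map_eval1[OF ring_map_const3]])
  finally show ?thesis .
qed

lemma split_degrees_ac_phi_pow: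
  assumes "CHAR('a::field) = 2" "j \<ge> 3"
  shows "split_degrees_ac (phi_pow j :: 'a poly3) = monom (phi_affine j) (j - 3)"
proof (rule poly_eqI)
  fix i
  have "phi_pow j = (phi_poly (monom 1 j) :: 'a poly3)"
    by (simp add: phi_pow_def phi_poly_def subst3_monom)
  hence "coeff (split_degrees_ac (phi_pow j :: 'a poly3)) i = C2 (to_ac (if j = i + 3 then 1 else 0)) * phi_affine (i + 3)"
    by (simp only: coeff_split_degrees_ac_phi_poly[OF assms(1)] coeff_monom)
  also have "\<dots> = coeff (monom (phi_affine j) (j - 3)) i"
    using assms(2) by (auto simp flip: one_pCons)
  finally show "coeff (split_degrees_ac (phi_pow j :: 'a poly3)) i = coeff (monom (phi_affine j) (j - 3)) i" .
qed

text \<open>Coprimality over the small field controls common divisors over its algebraic closure: an identity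
\<open>u \<phi>\<^sub>i + v \<phi>\<^sub>j = r\<close> with \<open>r \<noteq> 0\<close> free of \<open>z\<close> survives the extension, and a divisor of \<open>r\<close> is free of \<open>z\<close>.
For divisors whose degree in \<open>z\<close> equals their total degree this means that they are constant.\<close>
lemma common_divisor_degree_0:
  assumes char: "CHAR('a::field) = 2" and ij: "i \<ge> 3" "j \<ge> 3"
    and coprime: "coprime (phi_pow i :: 'a poly3) (phi_pow j)"
    and G: "G dvd (phi_affine i :: 'a alg_closure poly poly)" "G dvd phi_affine j"
  shows "degree G = 0"
proof -
  note R = ring_map_split_degrees_ac
  obtain u v r where r: "r \<noteq> 0" "u * phi_pow i + v * phi_pow j = ([:r:] :: 'a poly3)"
    using coprime_elimination[OF coprime] by blast
  have r': "split_degrees_ac [:r:] = split_degrees_ac u * monom (phi_affine i) (i - 3) + split_degrees_ac v * monom (phi_affine j) (j - 3)"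
    by (simp add: ring_map.add[OF R] ring_map.mult[OF R] split_degrees_ac_phi_pow char ij flip: r(2))
  have dvd: "G dvd coeff (split_degrees_ac [:r:]) n" for n
    unfolding r' using G by (simp add: coeff_monom_mult mult.commute[of _ "monom _ _"])
  have "map_poly3 to_ac [:r:] \<noteq> 0"
    using r(1) by (simp add: map_poly3_def map_poly_pCons map_poly_eq_0_iff)
  hence "split_degrees_ac [:r:] \<noteq> 0"
    by (simp add: split_degrees_ac_def split_degrees_eq_0_iff)
  then obtain n where n: "coeff (split_degrees_ac [:r:]) n \<noteq> 0"
    by (auto simp: poly_eq_iff)
  have "degree (coeff (split_degrees_ac [:r:]) n) \<le> 0"
    by (rule degree_le)
      (auto simp: poly_eq_iff split_degrees_ac_def coeff_split_degrees map_poly3_def map_poly_pCons coeff_pCons split: nat.splits)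
  thus ?thesis
    using dvd_imp_degree_le[OF dvd n] by simp
qed

section \<open>Factorisations of polynomials with Kasami leading form\<close>

context kasami
begin

text \<open>Every curve lies on \<open>A\<close> or on \<open>B\<close>. The curves on \<open>A\<close> force the degree of \<open>A\<close> to be at least \<open>q + 1\<close> times their
number, likewise for \<open>B\<close>. There are \<open>q - 2\<close> curves and the degree of the Kasami polynomial is
\<open>(q + 1) (q - 2)\<close>, so equality holds everywhere and no curve is counted twice.\<close>
lemma factor_degrees:
  assumes AB: "A * B = phi_affine e" and deg: "degree A \<le> s" "degree B \<le> t" "s + t + 3 = e"
  defines "I \<equiv> {a \<in> params. curve a A = 0}" and "J \<equiv> {a \<in> params. curve a B = 0}"
  shows "s = (q + 1) * card I" "t = (q + 1) * card J" "degree A = s" "degree B = t"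
    "I \<inter> J = {}"
proof -
  have fin: "finite I" "finite J"
    using card_params(1) by (simp_all add: I_def J_def)
  have "restrict_y0 A * restrict_y0 B \<noteq> 0"
    using restrict_y0_phi_affine by (simp add: AB flip: ring_map.mult[OF ring_map_restrict_y0])
  hence nz: "restrict_y0 A \<noteq> 0" "restrict_y0 B \<noteq> 0" by auto
  have "curve a A * curve a B = 0" if "a \<in> params" for a
    using curve_phi_affine[OF that] by (simp add: AB flip: ring_map.mult[OF ring_map_curve])
  hence "params = I \<union> J"
    by (auto simp: I_def J_def)
  hence card: "card I + card J = q - 2 + card (I \<inter> J)"
    using card_Un_Int[OF fin] card_params(2) by simp
  have A: "(q + 1) * card I \<le> degree (restrict_y0 A)" and B: "(q + 1) * card J \<le> degree (restrict_y0 B)"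
    by (intro degree_restrict_y0_ge nz; simp add: I_def J_def)+
  have ge: "(q + 1) * card I \<le> degree A" "(q + 1) * card J \<le> degree B"
    using A B degree_restrict_y0_le[of A] degree_restrict_y0_le[of B] by linarith+
  have total: "(q + 1) * (q - 2) + 3 = e"
  proof -
    have "2 \<le> q" using q_ge by linarith
    then obtain r where "q = 2 + r"
      using le_Suc_ex by blast
    with e show ?thesis
      by (simp add: power2_eq_square algebra_simps)
  qed
  have "(q + 1) * card I + (q + 1) * card J = (q + 1) * (q - 2) + (q + 1) * card (I \<inter> J)"
    by (simp only: card flip: distrib_left)
  \<comment> \<open>A common curve would exceed the total degree.\<close>
  moreover have "card (I \<inter> J) \<le> (q + 1) * card (I \<inter> J)"
    by simp
  ultimately have "s = (q + 1) * card I \<and> t = (q + 1) * card J \<and> degree A = s \<and> degree B = t \<and>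
      card (I \<inter> J) = 0"
    using ge deg total by linarith
  thus "s = (q + 1) * card I" "t = (q + 1) * card J" "degree A = s" "degree B = t" "I \<inter> J = {}"
    using fin by auto
qed

text \<open>\<open>P\<close> and \<open>Q\<close> are factors of a polynomial with leading form \<open>\<phi>\<^sub>e\<close> and second form a multiple of \<open>\<phi>\<^sub>d\<close>; their outer
variable records degrees. Write \<open>p\<^sub>i\<close> and \<open>r\<^sub>i\<close> for their components \<open>i\<close> degrees below the top and \<open>A\<close>, \<open>B\<close> for their
leading forms. In the gap the equations \<open>A r\<^sub>i + p\<^sub>i B = 0\<close> force \<open>p\<^sub>i = r\<^sub>i = 0\<close>, and at its end
\<open>A r\<^sub>m + p\<^sub>m B = c \<phi>\<^sub>d\<close> with \<open>m = e - d\<close>. As \<open>\<phi>\<^sub>d\<close> has multiplicity at most \<open>2\<close> at \<open>(1 : 1 : 1)\<close>, one of \<open>A\<close> and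
\<open>B\<close> contains at most two curves. If it is \<open>B\<close>, then \<open>Q\<close> has degree at most \<open>2 (q + 1) < m\<close>, so \<open>r\<^sub>m = 0\<close> and \<open>B\<close>
divides \<open>\<phi>\<^sub>d\<close>; the other case is symmetric.\<close>
lemma leading_factor_dvd:
  fixes P Q :: "'k poly3"
  assumes P: "\<And>i. degree (coeff P i) \<le> i" and Q: "\<And>i. degree (coeff Q i) \<le> i"
    and lead: "lead_coeff P * lead_coeff Q = phi_affine e" and e_deg: "degree P + degree Q + 3 = e"
    and gap: "\<And>i. d < i + 3 \<Longrightarrow> i + 3 < e \<Longrightarrow> coeff (P * Q) i = 0"
    and sub: "coeff (P * Q) (d - 3) = C2 c * phi_affine d" and c: "c \<noteq> 0"
    and d: "d mod 8 = 5" "d + 2 * (q + 1) < e"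
  shows "lead_coeff P dvd phi_affine d \<and> degree (lead_coeff P) = degree P \<or>
    lead_coeff Q dvd phi_affine d \<and> degree (lead_coeff Q) = degree Q"
proof -
  define A B where "A = lead_coeff P" and "B = lead_coeff Q"
  define s t where "s = degree P" and "t = degree Q"
  define I J where "I = {a \<in> params. curve a A = 0}" and "J = {a \<in> params. curve a B = 0}"
  have AB: "A * B = phi_affine e" and st: "s + t + 3 = e"
    using lead e_deg by (simp_all add: A_def B_def s_def t_def)
  have "degree A \<le> s" "degree B \<le> t"
    using P[of s] Q[of t] by (simp_all add: A_def B_def s_def t_def)
  note degs = factor_degrees[OF AB this st, folded I_def J_def]
  have PQ0: "P \<noteq> 0" "Q \<noteq> 0"
    using lead restrict_y0_phi_affine ring_map.zero[OF ring_map_restrict_y0] by (auto simp: A_def B_def)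
  define p r where "p i = coeff (reflect_poly P) i" and "r i = coeff (reflect_poly Q) i" for i
  have p0: "p 0 = A" and r0: "r 0 = B"
    by (simp_all add: p_def r_def A_def B_def)
  have deg_p: "degree (p i) \<le> s - i" and p_0: "i > s \<Longrightarrow> p i = 0"
    and deg_r: "degree (r i) \<le> t - i" and r_0: "i > t \<Longrightarrow> r i = 0" for i
    using P[of "s - i"] Q[of "t - i"]
    by (simp_all add: p_def r_def s_def t_def coeff_reflect_poly)
  have coeff_PQ: "(\<Sum>j\<le>i. p j * r (i - j)) = coeff (P * Q) (s + t - i)" if "i \<le> s + t" for i
    using that PQ0 coeff_mult[of "reflect_poly P" "reflect_poly Q" i]
    by (simp add: p_def r_def s_def t_def coeff_reflect_poly degree_mult_eq flip: reflect_poly_mult)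
  have two_terms: "(\<Sum>j\<le>i. p j * r (i - j)) = A * r i + p i * B"
    if "i > 0" "\<And>j. 0 < j \<Longrightarrow> j < i \<Longrightarrow> p j = 0" for i
  proof -
    have "(\<Sum>j\<le>i. p j * r (i - j)) = (\<Sum>j\<in>{0, i}. p j * r (i - j))"
      using that by (intro sum.mono_neutral_right) auto
    also have "\<dots> = A * r i + p i * B"
      using that(1) by (simp add: p0 r0)
    finally show ?thesis .
  qed
  have d5: "d \<ge> 5"
    using d(1) mod_less_eq_dividend[of d 8] by simp
  have zero: "p i = 0 \<and> r i = 0" if "0 < i" "i < e - d" for i
    using that
  proof (induction i rule: less_induct)
    case (less i)
    have i: "i \<le> s + t" using less.prems st d5 by linarith
    have "coeff (P * Q) (s + t - i) = 0"
      using less.prems st d5 by (intro gap) linarith+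
    hence eq: "A * r i + p i * B = 0"
      using less coeff_PQ[OF i] by (subst two_terms[symmetric]) auto
    have curve_eq: "curve a A * curve a (r i) + curve a (p i) * curve a B = 0" for a
      using arg_cong[OF eq, of "curve a"]
      by (simp add: ring_map.add[OF ring_map_curve] ring_map.mult[OF ring_map_curve]
          ring_map.zero[OF ring_map_curve])
    \<comment> \<open>Restrict the equation to the curves on \<open>A\<close>, where \<open>B\<close> does not vanish.\<close>
    have "p i = 0"
    proof (cases "i > s")
      case False
      show ?thesis
      proof (rule zero_if_curves_vanish[of I])
        show "I \<subseteq> params" by (auto simp: I_def)
        show "curve a (p i) = 0" if "a \<in> I" for a
          using curve_eq[of a] that degs(5) by (auto simp: I_def J_def)
        show "degree (p i) < (q + 1) * card I"
          using deg_p[of i] False less.prems(1) unfolding degs(1)[symmetric] by linarith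
      qed
    qed (rule p_0)
    \<comment> \<open>Symmetrically, restrict it to the curves on \<open>B\<close>.\<close>
    moreover have "r i = 0"
    proof (cases "i > t")
      case False
      show ?thesis
      proof (rule zero_if_curves_vanish[of J])
        show "J \<subseteq> params" by (auto simp: J_def)
        show "curve a (r i) = 0" if "a \<in> J" for a
          using curve_eq[of a] that degs(5) by (auto simp: I_def J_def)
        show "degree (r i) < (q + 1) * card J"
          using deg_r[of i] False less.prems(1) unfolding degs(2)[symmetric] by linarith
      qed
    qed (rule r_0)
    ultimately show ?case ..
  qed
  define m where "m = e - d"
  have m: "m > 0" "m \<le> s + t" "s + t - m = d - 3" "2 * (q + 1) < m"
    using d(2) d5 st by (simp_all add: m_def)
  have "A * r m + p m * B = (\<Sum>j\<le>m. p j * r (m - j))"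
    using zero m(1) by (subst two_terms) (simp_all add: m_def)
  also have "\<dots> = C2 c * phi_affine d"
    using coeff_PQ[OF m(2)] sub by (simp only: m(3))
  finally have eq: "A * r m + p m * B = C2 c * phi_affine d" .
  have cancel_c: "C2 (inverse c) * (C2 c * W) = W" for W
    using c by (simp flip: one_pCons)
  have unit: "G dvd phi_affine d" if "G dvd C2 c * phi_affine d" for G :: "'k poly poly"
  proof -
    have "G dvd C2 (inverse c) * (C2 c * phi_affine d)"
      using that by (rule dvd_mult)
    thus ?thesis by (simp only: cancel_c)
  qed
  \<comment> \<open>Otherwise both summands, hence also \<open>\<phi>\<^sub>d\<close>, have multiplicity at least \<open>3\<close> at \<open>(1 : 1 : 1)\<close>.\<close>
  have "card I \<le> 2 \<or> card J \<le> 2"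
  proof (rule ccontr)
    assume "\<not> ?thesis"
    hence "Z2 ^ 3 dvd (Z2 ^ card I :: 'k poly poly)" "Z2 ^ 3 dvd (Z2 ^ card J :: 'k poly poly)"
      by (simp_all add: le_imp_power_dvd)
    moreover have "Z2 ^ card I dvd dilate A" "Z2 ^ card J dvd dilate B"
      by (rule dvd_dilate_if_curves_vanish; simp add: I_def J_def)+
    ultimately have "Z2 ^ 3 dvd dilate A" "Z2 ^ 3 dvd dilate B"
      by (metis dvd_trans)+
    hence "Z2 ^ 3 dvd dilate (A * r m + p m * B)"
      by (simp add: ring_map.add[OF ring_map_dilate] ring_map.mult[OF ring_map_dilate])
    hence "Z2 ^ 3 dvd dilate (C2 c * phi_affine d)"
      by (simp only: eq)
    hence "Z2 ^ 3 dvd dilate (C2 (inverse c)) * dilate (C2 c * phi_affine d)"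
      by (rule dvd_mult)
    also have "\<dots> = dilate (C2 (inverse c) * (C2 c * phi_affine d))"
      by (simp only: ring_map.mult[OF ring_map_dilate])
    finally have "Z2 ^ 3 dvd dilate (phi_affine d :: 'k poly poly)"
      by (simp only: cancel_c)
    thus False
      using not_dvd_dilate_phi_affine[OF two d(1)] by contradiction
  qed
  thus ?thesis
  proof
    assume "card I \<le> 2"
    hence "s < m"
      using m(4) mult_le_mono2[of "card I" 2 "q + 1"] unfolding degs(1) by linarith
    hence "A * r m = C2 c * phi_affine d"
      using eq by (simp add: p_0)
    hence "A dvd phi_affine d"
      by (intro unit) (metis dvd_triv_left)
    thus ?thesis using degs(3) by (simp add: A_def s_def)
  next
    assume "card J \<le> 2"
    hence "t < m"
      using m(4) mult_le_mono2[of "card J" 2 "q + 1"] unfolding degs(2) by linarith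
    hence "p m * B = C2 c * phi_affine d"
      using eq by (simp add: r_0)
    hence "B dvd phi_affine d"
      by (intro unit) (metis dvd_triv_right)
    thus ?thesis using degs(4) by (simp add: B_def t_def)
  qed
qed

end

theorem theorem6:
  fixes n k :: nat and h :: "'a::finite_field poly"
  assumes "n > 0" and "CARD('a) = 2 ^ n" and "k > 0"
    and "[degree h = 5] (mod 8)"
    and "int (degree h) < 2 ^ (2 * k) - 3 * 2 ^ k - 1"
    and "coprime (phi_pow (2 ^ (2 * k) - 2 ^ k + 1) :: 'a poly3) (phi_pow (degree h))"
  shows "absolutely_irreducible (phi_poly (monom 1 (2 ^ (2 * k) - 2 ^ k + 1) + h))"
proof -
  define q e d :: nat where "q = 2 ^ k" and "e = 2 ^ (2 * k) - 2 ^ k + 1" and "d = degree h"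
  define f where "f = monom 1 e + h"
  have q2: "q ^ 2 = 2 ^ (2 * k)"
    by (simp add: q_def mult.commute flip: power_mult)
  have "CHAR('a) dvd 2 ^ n"
    using CHAR_dvd_CARD[where 'a = 'a] assms(2) by simp
  moreover have "prime CHAR('a)"
    using prime_CHAR_semidom[where 'a = 'a] finite_imp_CHAR_pos[where 'a = 'a] by simp
  ultimately have char: "CHAR('a) = 2"
    by (metis prime_dvd_power primes_dvd_imp_eq two_is_prime_nat)
  hence two: "(2 :: 'a alg_closure) = 0"
    using of_nat_CHAR[where 'a = "'a alg_closure"] by simp
  have d_mod: "d mod 8 = 5" using assms(4) by (simp add: cong_def d_def)
  hence d5: "d \<ge> 5" using mod_less_eq_dividend[of d 8] by simp
  have "int d < int (q ^ 2) - 3 * int q - 1"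
    using assms(5) by (simp only: q2) (simp add: d_def q_def)
  moreover have "q \<le> q ^ 2" by (simp add: power2_eq_square)
  hence e_eq: "e + q = q ^ 2 + 1" by (simp add: e_def q_def flip: q2)
  moreover have "d + 2 * (q + 1) < e" if "int d < int Q - 3 * int q - 1" "e + q = Q + 1" for Q
    using that by (simp add: algebra_simps)
  ultimately have gap: "d + 2 * (q + 1) < e"
    by blast
  \<comment> \<open>For \<open>k = 1\<close> the bound on the degree is negative.\<close>
  have "k \<ge> 2"
  proof (rule ccontr)
    assume "\<not> k \<ge> 2"
    hence "k = 1" using assms(3) by linarith
    with gap e_eq show False by (simp add: q_def)
  qed
  interpret kasami "TYPE('a alg_closure)" k q e
    by standard (use two q_def \<open>k \<ge> 2\<close> e_eq in auto)
  have coeff_f: "coeff f e = 1" "coeff f d \<noteq> 0" "\<And>j. d < j \<Longrightarrow> j \<noteq> e \<Longrightarrow> coeff f j = 0"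
    using gap d5 by (auto simp: f_def d_def coeff_eq_0)
  define F where "F = split_degrees_ac (phi_poly f)"
  have coeff_F: "coeff F i = C2 (to_ac (coeff f (i + 3))) * phi_affine (i + 3)" for i
    unfolding F_def by (rule coeff_split_degrees_ac_phi_poly[OF char])
  have F_top: "coeff F (e - 3) = phi_affine e"
    using coeff_f(1) gap by (simp add: coeff_F flip: one_pCons)
  have phi_affine_e: "(phi_affine e :: 'a alg_closure poly poly) \<noteq> 0"
    using restrict_y0_phi_affine ring_map.zero[OF ring_map_restrict_y0] by metis
  have deg_F: "degree F = e - 3"
  proof (rule antisym)
    show "degree F \<le> e - 3"
      using gap by (intro degree_le) (auto simp: coeff_F coeff_f(3))
    show "e - 3 \<le> degree F"
      using phi_affine_e by (intro le_degree) (simp add: F_top)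
  qed
  define Phi where "Phi = map_poly3 to_ac (phi_poly f)"
  have F_Phi: "F = split_degrees Phi"
    by (simp add: F_def split_degrees_ac_def Phi_def)
  have F_nz: "F \<noteq> 0"
    using deg_F gap d5 by auto
  have "irreducible Phi"
  proof (rule irreducibleI)
    show "Phi \<noteq> 0"
      using F_nz by (simp add: F_Phi split_degrees_eq_0_iff)
    show "\<not> is_unit Phi"
      using degree_split_degrees_unit[of Phi] deg_F gap d5 by (auto simp: F_Phi)
    fix P Q assume Phi: "Phi = P * Q"
    define P' Q' where "P' = split_degrees P" and "Q' = split_degrees Q"
    have F: "F = P' * Q'"
      by (simp add: F_Phi Phi P'_def Q'_def ring_map.mult[OF ring_map_split_degrees])
    have nz: "P' \<noteq> 0" "Q' \<noteq> 0" "P \<noteq> 0" "Q \<noteq> 0"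
      using F_nz F by (auto simp: P'_def Q'_def split_degrees_eq_0_iff)
    have deg_sum: "degree P' + degree Q' + 3 = e"
      using deg_F gap d5 nz by (simp add: F degree_mult_eq)
    have lead: "lead_coeff P' * lead_coeff Q' = phi_affine e"
      using F_top deg_F unfolding lead_coeff_mult[symmetric] F[symmetric] by simp
    have "lead_coeff P' dvd phi_affine d \<and> degree (lead_coeff P') = degree P' \<or>
        lead_coeff Q' dvd phi_affine d \<and> degree (lead_coeff Q') = degree Q'"
    proof (rule leading_factor_dvd)
      show "degree (coeff P' i) \<le> i" "degree (coeff Q' i) \<le> i" for i
        by (simp_all add: P'_def Q'_def degree_coeff_split_degrees)
      show "coeff (P' * Q') (d - 3) = C2 (to_ac (coeff f d)) * phi_affine d"
        using d5 unfolding F[symmetric] coeff_F by simp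
      show "coeff (P' * Q') i = 0" if "d < i + 3" "i + 3 < e" for i
        using that unfolding F[symmetric] coeff_F by (simp add: coeff_f(3))
    qed (use lead deg_sum coeff_f(2) d_mod gap in auto)
    \<comment> \<open>A leading form dividing both has its full degree in \<open>z\<close>, so it is constant by coprimality.\<close>
    moreover have "degree G = 0" if "G dvd phi_affine e" "G dvd phi_affine d" for G :: "'a alg_closure poly poly"
      using common_divisor_degree_0[OF char _ _ _ that] assms(6) gap d5 by (simp add: e_def d_def)
    ultimately have "degree P' = 0 \<or> degree Q' = 0"
      using lead by (metis dvd_triv_left dvd_triv_right)
    thus "is_unit P \<or> is_unit Q"
      using is_unit_of_degree_split_degrees nz by (auto simp: P'_def Q'_def)
  qed
  thus ?thesis
    by (simp add: absolutely_irreducible_def Phi_def map_poly3_def f_def e_def)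
qed

end
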